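(* Let $\lambda\in\mathcal{M}_+(S^1)$ with closed support $\operatorname{supp}\lambda\subset S^1$, and fix $c_0\in\mathbb{R}$. Suppose that $$Z'=\big(N_0(\lambda)\cap\operatorname{supp}\lambda\big)\cup\{z\in S^1\setminus\operatorname{supp}\lambda\;|\;H[\lambda](z)+c_0=0\}$$ is discrete, i.e. for each $z\in Z'$ there is $\varepsilon>0$ such that $|z-z'|>\varepsilon$ for every $z'\in Z'$ with $z'\ne z$. Let $\lambda_c\in L^1(S^1)$ be the density of the (absolutely) continuous component of $\lambda$ with respect to the normalized Lebesgue measure $(2\pi)^{-1}d\theta$, and write $\mathcal{B}[\lambda,c_0]=(\mu,\zeta_0)$. Then $$d\mu(\theta)=(2\pi)^{-1}\mu_c(e^{i\theta})\,d\theta+\sum_{e^{i\theta_i}\in Z}\beta_i\,\delta(\theta-\theta_i)\,d\theta,$$ where $$\mu_c(e^{i\theta})=\frac{\lambda_c(e^{i\theta})}{\lambda_c(e^{i\theta})^2+\big(H[\lambda](e^{i\theta})+c_0\big)^2}\in L^1(S^1),$$ $$\beta_i=\left(\int\frac{d\lambda(\theta)}{\sin^2[(\theta-\theta_i)/2]}\right)^{-1}$$ for all $e^{i\theta_i}$ in the discrete set $$Z=N_0(\lambda)\cap\{z\in S^1\;|\;H[\lambda](z)+c_0=0\}\subset Z',$$ and $\zeta_0=\operatorname{Im}\big[(\|\lambda\|+ic_0)^{-1}\big]$.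
   Context: $\mathbb{D}$ is the open unit disc, $S^1$ the unit circle, $\mathcal{M}_+(S^1)$ the set of nonzero finite non-negative Borel measures on $S^1$, and $\|\lambda\|$ the total mass. For $\lambda\in\mathcal{M}_+(S^1)$ and $\sigma\in\mathbb{R}$ put $$Q[\lambda](z)=\int_0^{2\pi}\frac{1+e^{-i\theta}z}{1-e^{-i\theta}z}\,d\lambda(\theta),\qquad Q_\sigma[\lambda]=Q[\lambda]+i\sigma\qquad(z\in\mathbb{D}),$$ and $H[\lambda](e^{i\theta})=\lim_{r\to1^-}\operatorname{Im}Q[\lambda](re^{i\theta})$, defined for almost every $\theta$. For every $(\lambda,c_0)\in\mathcal{M}_+(S^1)\times\mathbb{R}$ there is a unique $(\mu,\zeta_0)\in\mathcal{M}_+(S^1)\times\mathbb{R}$ with $Q_{c_0}[\lambda]\,Q_{\zeta_0}[\mu]\equiv1$ on $\mathbb{D}$; one writes $\mathcal{B}[\lambda,c_0]=(\mu,\zeta_0)$. The zero set of $\lambda$ is $$N_0(\lambda)=\bigcap_{\varepsilon>0}\operatorname{clos}\Big\{e^{i\theta}\in S^1\;\Big|\;\limsup_{\delta\to0}\lambda(\exp i[\theta-\delta,\theta+\delta])/2\delta<\varepsilon\Big\}.$$ $\delta(\theta-\theta_i)\,d\theta$ denotes the unit point mass at $e^{i\theta_i}$. Convention: $1/\infty=0$ in the definition of $\beta_i$. *)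

theory Defs
  imports "HOL-Probability.Probability"
begin

text \<open>
  Measures on the unit circle are measures on the Borel sets of \<open>sphere 0 1\<close> in the complex plane;
  the angular variable \<open>\<theta>\<close> becomes the point \<open>w = exp (\<i>\<theta>)\<close>.
\<close>

definition circle_borel :: "complex measure" where
  "circle_borel = restrict_space borel (sphere 0 1)"

definition circle_lebesgue :: "complex measure" where
  \<comment> \<open>the normalized measure \<open>d\<theta> / (2\<pi>)\<close>\<close>
  "circle_lebesgue = distr (uniform_measure lborel {0..<2 * pi}) circle_borel cis"

definition M_plus :: "complex measure set" where
  "M_plus = {lam. sets lam = sets circle_borel \<and> finite_measure lam \<and> emeasure lam (space lam) \<noteq> 0}"

definition total_mass :: "complex measure \<Rightarrow> real" where
  "total_mass lam = measure lam (space lam)"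

definition supp :: "complex measure \<Rightarrow> complex set" where
  "supp lam = {z \<in> sphere 0 1. \<forall>U. open U \<longrightarrow> z \<in> U \<longrightarrow> emeasure lam (U \<inter> sphere 0 1) > 0}"

definition Q :: "complex measure \<Rightarrow> complex \<Rightarrow> complex" where
  \<comment> \<open>\<open>cnj w\<close> is \<open>exp (- \<i>\<theta>)\<close> for \<open>w = exp (\<i>\<theta>)\<close>\<close>
  "Q lam z = (\<integral>w. (1 + cnj w * z) / (1 - cnj w * z) \<partial>lam)"

definition Q_shift :: "real \<Rightarrow> complex measure \<Rightarrow> complex \<Rightarrow> complex" where
  "Q_shift \<sigma> lam z = Q lam z + \<i> * of_real \<sigma>"

definition has_H :: "complex measure \<Rightarrow> complex \<Rightarrow> real \<Rightarrow> bool" where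
  "has_H lam z h \<longleftrightarrow> ((\<lambda>r. Im (Q lam (of_real r * z))) \<longlongrightarrow> h) (at_left 1)"

definition H :: "complex measure \<Rightarrow> complex \<Rightarrow> real" where
  \<comment> \<open>meaningful only where the radial limit exists, which is almost everywhere\<close>
  "H lam z = Lim (at_left 1) (\<lambda>r. Im (Q lam (of_real r * z)))"

definition H_level :: "complex measure \<Rightarrow> real \<Rightarrow> complex set" where
  \<comment> \<open>the points of the circle at which the limit defining \<open>H\<close> exists and \<open>H + c0\<close> vanishes\<close>
  "H_level lam c0 = {z \<in> sphere 0 1. (\<exists>h. has_H lam z h) \<and> H lam z + c0 = 0}"

definition B_rel :: "complex measure \<times> real \<Rightarrow> complex measure \<times> real \<Rightarrow> bool" where
  \<comment> \<open>the graph of the map \<open>(\<lambda>, c0) \<mapsto> (\<mu>, \<zeta>0)\<close>\<close>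
  "B_rel = (\<lambda>(lam, c0) (mu, \<zeta>0). mu \<in> M_plus \<and>
     (\<forall>z\<in>ball 0 1. Q_shift c0 lam z * Q_shift \<zeta>0 mu z = 1))"

definition zero_set :: "complex measure \<Rightarrow> complex set" where
  "zero_set lam = (\<Inter>\<epsilon>\<in>{0<..}. closure {cis \<theta> | \<theta>::real.
     Limsup (at_right 0) (\<lambda>\<delta>. emeasure lam (cis ` {\<theta> - \<delta>..\<theta> + \<delta>}) / ennreal (2 * \<delta>)) < ennreal \<epsilon>})"

definition discrete_set :: "complex set \<Rightarrow> bool" where
  "discrete_set S \<longleftrightarrow> (\<forall>z\<in>S. \<exists>\<epsilon>>0. \<forall>z'\<in>S. z' \<noteq> z \<longrightarrow> dist z z' > \<epsilon>)"

definition is_ac_density :: "complex measure \<Rightarrow> (complex \<Rightarrow> real) \<Rightarrow> bool" where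
  \<comment> \<open>Lebesgue decomposition: \<open>f\<close> is an \<open>L\<^sup>1\<close> representative of the density of the absolutely
     continuous part, \<open>s\<close> the singular part, carried by the null set \<open>N\<close>\<close>
  "is_ac_density lam f \<longleftrightarrow>
     integrable circle_lebesgue f \<and> (AE z in circle_lebesgue. 0 \<le> f z) \<and>
     (\<exists>s N. sets s = sets circle_borel \<and> N \<in> null_sets circle_lebesgue \<and> emeasure s (space s - N) = 0 \<and>
        (\<forall>A\<in>sets circle_borel.
           emeasure lam A = (\<integral>\<^sup>+z\<in>A. ennreal (f z) \<partial>circle_lebesgue) + emeasure s A))"

definition beta :: "complex measure \<Rightarrow> complex \<Rightarrow> ennreal" where
  \<comment> \<open>in \<^typ>\<open>ennreal\<close>, \<open>inverse 0 = \<infinity>\<close> and \<open>inverse \<infinity> = 0\<close>; any branch of the argument would do,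
     since \<open>sin\<^sup>2\<close> has period \<open>\<pi>\<close>\<close>
  "beta lam \<zeta> = inverse (\<integral>\<^sup>+w. inverse (ennreal ((sin ((Arg w - Arg \<zeta>) / 2))\<^sup>2)) \<partial>lam)"

end

theory Submission
  imports Defs "HOL-Complex_Analysis.Complex_Analysis"
begin

text \<open>
  Let \<open>F = Q lam + \<i> * c0\<close>. By hypothesis \<open>1 / F\<close> is the Herglotz integral of \<open>mu\<close> plus an imaginary
  constant, so everything about \<open>mu\<close> is read off from the boundary behaviour of \<open>1 / F\<close>.

  The real part of a Herglotz integral is a Poisson integral. Almost everywhere with respect to Lebesgue
  measure its radial limit is the density of the absolutely continuous part
  (\<open>AE_poisson_tendsto_density\<close>), and almost everywhere with respect to the singular part it tends to
  infinity (\<open>AE_poisson_tendsto_top\<close>). Both facts come from one covering inequality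
  (\<open>emeasure_Union_balls_le\<close>). The full integral, imaginary part included, also has finite radial limits
  almost everywhere (\<open>AE_Q_convergent\<close>): a square root of \<open>1 + Q\<close> takes values in a quarter-plane sector,
  so rotations of it by \<open>45\<close> degrees in both directions again have positive real part, are Herglotz
  integrals (\<open>Herglotz_representation\<close>), and have convergent real parts.

  Applied to \<open>lam\<close> and \<open>mu\<close>, the limits of \<open>F\<close> and \<open>1 / F\<close> are finite almost everywhere, and the density
  of \<open>mu\<close> is the real part of \<open>1 / (lam_c + \<i> * (H + c0))\<close>, which is \<open>mu_c\<close>. The singular part of \<open>mu\<close> is
  carried by the points where \<open>1 / F\<close> blows up, hence where \<open>F\<close> tends to 0 radially. At such a point
  \<open>H + c0\<close> vanishes, and since small Poisson integrals force small mass on short arcs, the point belongs to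
  the zero set of \<open>lam\<close>. So the singular part lives on \<open>Z\<close>. A discrete set is countable, so it is a
  sum of atoms.

  The atom at \<open>x\<close> is the limit of \<open>(1 - r) / (2 * F (r * x))\<close>. For \<open>x\<close> in \<open>Z\<close> the quotient
  \<open>F (r * x) / (1 - r)\<close> tends to twice the integral of \<open>\<bar>w - x\<bar>\<^sup>-\<^sup>2\<close> when that is finite, and the atom is
  zero when it is infinite (\<open>measure_singleton_reciprocal\<close>). As \<open>\<bar>w - x\<bar> = 2 * \<bar>sin\<bar>\<close> of half the angle between
  the points, this is the stated \<open>beta\<close>.
\<close>

section \<open>Poisson integrals of measures on the circle\<close>

definition schwarz_kernel :: "complex \<Rightarrow> complex \<Rightarrow> complex" where
  "schwarz_kernel w z = (1 + cnj w * z) / (1 - cnj w * z)"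

definition poisson_kernel :: "complex \<Rightarrow> complex \<Rightarrow> real" where
  "poisson_kernel w z = (1 - (norm z)\<^sup>2) / (norm (w - z))\<^sup>2"

text \<open>
  Extended non-negative values make this additive and monotone in the measure, with no integrability
  side conditions; the identity \<open>poisson_eq\<close> below recovers the real part of \<open>Q\<close>.
\<close>
definition poisson :: "complex measure \<Rightarrow> complex \<Rightarrow> ennreal" where
  "poisson M z = (\<integral>\<^sup>+w. ennreal (poisson_kernel w z) \<partial>M)"

lemma norm_one_minus_cnj_mult:
  assumes "norm w = 1"
  shows "norm (1 - cnj w * z) = norm (w - z)"
proof -
  have "cnj w * w = 1"
    using assms by (simp add: complex_norm_square[symmetric] mult.commute)
  then have "1 - cnj w * z = cnj w * (w - z)"
    by (simp add: algebra_simps)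
  then show ?thesis using assms by (simp add: norm_mult)
qed

lemma norm_diff_ge:
  assumes "norm w = 1" shows "1 - norm z \<le> norm (w - z)"
  using norm_triangle_ineq2[of w z] assms by simp

lemma norm_radial_diff:
  fixes x :: complex
  assumes "norm x = 1" "r \<le> 1"
  shows "norm (x - of_real r * x) = 1 - r"
proof -
  have "x - of_real r * x = of_real (1 - r) * x" by (simp add: algebra_simps)
  then show ?thesis using assms by (simp add: norm_mult del: of_real_diff)
qed

lemma Re_schwarz_kernel:
  assumes w: "norm w = 1"
  shows "Re (schwarz_kernel w z) = poisson_kernel w z"
proof (cases "w = z")
  case True
  then show ?thesis
    using w by (simp add: schwarz_kernel_def poisson_kernel_def complex_norm_square[symmetric] mult.commute)
next
  case False
  define t where "t = cnj w * z"
  have nt: "norm t = norm z" using w by (simp add: t_def norm_mult)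
  have "Re ((1 + t) / (1 - t)) = (1 - (norm t)\<^sup>2) / (norm (1 - t))\<^sup>2"
    unfolding cmod_power2 by (simp add: Re_divide power2_eq_square algebra_simps)
  then show ?thesis
    using norm_one_minus_cnj_mult[OF w, of z] nt
    by (simp add: schwarz_kernel_def poisson_kernel_def t_def)
qed

lemma norm_schwarz_kernel_le:
  assumes w: "norm w = 1" and z: "norm z < 1"
  shows "norm (schwarz_kernel w z) \<le> 2 / (1 - norm z)"
proof -
  have "norm (1 + cnj w * z) \<le> 2"
    using norm_triangle_ineq[of 1 "cnj w * z"] w z by (simp add: norm_mult)
  moreover have "1 - norm z \<le> norm (1 - cnj w * z)"
    using norm_diff_ge[OF w, of z] norm_one_minus_cnj_mult[OF w, of z] by simp
  ultimately show ?thesis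
    unfolding schwarz_kernel_def norm_divide using z by (intro frac_le) auto
qed

lemma poisson_kernel_nonneg: "norm z \<le> 1 \<Longrightarrow> 0 \<le> poisson_kernel w z"
  by (simp add: poisson_kernel_def abs_square_le_1)

lemma cnj_measurable [measurable]: "cnj \<in> borel_measurable borel"
  by (intro borel_measurable_continuous_onI continuous_intros)

lemma schwarz_kernel_measurable [measurable]:
  "(\<lambda>w. schwarz_kernel w z) \<in> borel_measurable borel"
  unfolding schwarz_kernel_def by measurable

lemma poisson_kernel_measurable [measurable]:
  "(\<lambda>w. poisson_kernel w z) \<in> borel_measurable borel"
  unfolding poisson_kernel_def by measurable

text \<open>
  The circle enters only through the condition that almost every point has norm 1. Keeping the
  measures on the Borel sets of the plane allows plane balls to replace arcs throughout.
\<close>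
locale circle_measure = finite_measure M for M :: "complex measure" +
  assumes sets_eq [measurable_cong, simp]: "sets M = sets borel"
    and AE_circle: "AE w in M. norm w = 1"
begin

lemma space_eq [simp]: "space M = UNIV"
  using sets_eq_imp_space_eq[OF sets_eq] by simp

lemma integrable_schwarz_kernel:
  assumes "norm z < 1"
  shows "integrable M (\<lambda>w. schwarz_kernel w z)"
  by (rule integrable_const_bound[where B="2 / (1 - norm z)"])
     (use AE_circle norm_schwarz_kernel_le[OF _ assms] in auto)

lemma Q_altdef: "Q M z = (\<integral>w. schwarz_kernel w z \<partial>M)"
  by (simp add: Q_def schwarz_kernel_def)

lemma integrable_poisson_kernel:
  assumes "norm z < 1"
  shows "integrable M (\<lambda>w. poisson_kernel w z)"
  by (rule iffD1[OF integrable_cong_AE integrable_Re[OF integrable_schwarz_kernel[OF assms]]])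
     (use AE_circle Re_schwarz_kernel in auto)

lemma Re_Q:
  assumes "norm z < 1"
  shows "Re (Q M z) = (\<integral>w. poisson_kernel w z \<partial>M)"
  unfolding Q_altdef integral_Re[OF integrable_schwarz_kernel[OF assms], symmetric]
  by (rule integral_cong_AE) (use AE_circle Re_schwarz_kernel in auto)

lemma poisson_eq:
  assumes "norm z < 1"
  shows "poisson M z = ennreal (Re (Q M z))"
  unfolding poisson_def Re_Q[OF assms]
  by (rule nn_integral_eq_integral[OF integrable_poisson_kernel[OF assms]])
     (use poisson_kernel_nonneg assms in auto)

lemma Re_Q_nonneg:
  assumes "norm z < 1"
  shows "0 \<le> Re (Q M z)"
  unfolding Re_Q[OF assms] using assms by (intro Bochner_Integration.integral_nonneg poisson_kernel_nonneg) auto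

text \<open>
  Expanding the kernel as \<open>1 + 2 \<Sum>(cnj w * z) ^ n\<close> and integrating termwise exhibits \<open>Q\<close> as a power
  series whose coefficients are, up to the factor 2, the conjugate moments of the measure.
\<close>
lemma Q_holomorphic: "Q M holomorphic_on ball 0 1"
proof -
  define a where "a n = (if n = 0 then 1 else 2) * (\<integral>w. cnj w ^ n \<partial>M)" for n
  have int: "integrable M (\<lambda>w. cnj w ^ n)" for n
    by (rule integrable_const_bound[where B=1])
       (use AE_circle in \<open>auto simp: norm_power\<close>)
  show ?thesis
  proof (rule power_series_holomorphic)
    fix z :: complex assume "z \<in> ball 0 1"
    then have z: "norm z < 1" by simp
    define c :: "nat \<Rightarrow> complex" where "c n = (if n = 0 then 1 else 2)" for n
    have c: "norm (c n) \<le> 2" for n by (simp add: c_def)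
    have int': "integrable M (\<lambda>w. c n * (cnj w * z) ^ n)" for n
      using int[of n] by (simp add: power_mult_distrib)
    have bd: "norm (c n * (cnj w * z) ^ n) \<le> 2 * norm z ^ n" if "norm w = 1" for n w
      using c[of n] that by (simp add: norm_mult norm_power power_mult_distrib mult_right_mono)
    have ker: "(\<lambda>n. c n * (cnj w * z) ^ n) sums schwarz_kernel w z" if w: "norm w = 1" for w
    proof -
      define t where "t = cnj w * z"
      have t: "norm t < 1" using w z by (simp add: t_def norm_mult)
      then have "t \<noteq> 1" by auto
      have "(\<lambda>n. 2 * t ^ n) sums (2 * (1 / (1 - t)))"
        using geometric_sums[OF t] by (rule sums_mult)
      then have "(\<lambda>n. 2 * t ^ n - (if n = 0 then 1 else 0)) sums (2 * (1 / (1 - t)) - 1)"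
        by (rule sums_diff) (use sums_single[of 0 "\<lambda>_. 1::complex"] in \<open>simp add: eq_commute\<close>)
      moreover have "2 * (1 / (1 - t)) - 1 = (1 + t) / (1 - t)"
        using \<open>t \<noteq> 1\<close> by (simp add: field_simps)
      moreover have "(\<lambda>n. 2 * t ^ n - (if n = 0 then 1 else 0)) = (\<lambda>n. c n * t ^ n)"
        by (auto simp: c_def fun_eq_iff)
      ultimately show ?thesis by (simp add: schwarz_kernel_def t_def)
    qed
    have "(\<lambda>n. \<integral>w. c n * (cnj w * z) ^ n \<partial>M) sums (\<integral>w. (\<Sum>n. c n * (cnj w * z) ^ n) \<partial>M)"
    proof (rule sums_integral[OF int'])
      show "AE w in M. summable (\<lambda>n. norm (c n * (cnj w * z) ^ n))"
        using AE_circle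
      proof eventually_elim
        case (elim w)
        show ?case
          by (rule summable_comparison_test'[where N=0 and g="\<lambda>n. 2 * norm z ^ n"])
             (use bd[OF elim] z in \<open>auto intro!: summable_mult summable_geometric\<close>)
      qed
      show "summable (\<lambda>n. \<integral>w. norm (c n * (cnj w * z) ^ n) \<partial>M)"
      proof (rule summable_comparison_test'[where N=0 and g="\<lambda>n. measure M UNIV * (2 * norm z ^ n)"])
        fix n
        have "(\<integral>w. norm (c n * (cnj w * z) ^ n) \<partial>M) \<le> (\<integral>w. 2 * norm z ^ n \<partial>M)"
          by (rule integral_mono_AE) (use int' AE_circle bd in auto)
        then show "norm (\<integral>w. norm (c n * (cnj w * z) ^ n) \<partial>M) \<le> measure M UNIV * (2 * norm z ^ n)"
          by (simp add: integral_nonneg)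
      qed (use z in \<open>auto intro!: summable_mult summable_geometric\<close>)
    qed
    moreover have "(\<integral>w. (\<Sum>n. c n * (cnj w * z) ^ n) \<partial>M) = Q M z"
      unfolding Q_altdef
    proof (rule integral_cong_AE)
      show "AE w in M. (\<Sum>n. c n * (cnj w * z) ^ n) = schwarz_kernel w z"
        using AE_circle by eventually_elim (simp add: sums_unique[OF ker, symmetric])
    qed (auto intro!: borel_measurable_suminf borel_measurable_integrable int')
    moreover have "(\<integral>w. c n * (cnj w * z) ^ n \<partial>M) = a n * (z - 0) ^ n" for n
      by (simp add: a_def c_def power_mult_distrib)
    ultimately show "(\<lambda>n. a n * (z - 0) ^ n) sums Q M z" by simp
  qed
qed

end

section \<open>A covering inequality\<close>

lemma emeasure_UN_le_nn_integral:
  assumes X [measurable]: "\<And>i. i \<in> I \<Longrightarrow> X i \<in> sets M" and I: "countable I"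
  shows "emeasure M (\<Union>(X ` I)) \<le> (\<integral>\<^sup>+i. emeasure M (X i) \<partial>count_space I)"
proof -
  have "emeasure M (\<Union>(X ` I)) = (\<integral>\<^sup>+x. indicator (\<Union>(X ` I)) x \<partial>M)"
    by (rule nn_integral_indicator[symmetric]) (use I in auto)
  also have "\<dots> \<le> (\<integral>\<^sup>+x. \<integral>\<^sup>+i. indicator (X i) x \<partial>count_space I \<partial>M)"
  proof (intro nn_integral_mono)
    fix x
    show "indicator (\<Union>(X ` I)) x \<le> (\<integral>\<^sup>+i. indicator (X i) x \<partial>count_space I)"
    proof (cases "x \<in> \<Union>(X ` I)")
      case True
      then obtain i where i: "i \<in> I" "x \<in> X i" by auto
      then have "1 \<le> (\<integral>\<^sup>+i. indicator (X i) x \<partial>count_space I)"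
        using nn_integral_ge_point[OF i(1), of "\<lambda>i. indicator (X i) x"] by simp
      then show ?thesis using True by (metis indicator_simps(1))
    qed simp
  qed
  also have "\<dots> = (\<integral>\<^sup>+i. \<integral>\<^sup>+x. indicator (X i) x \<partial>M \<partial>count_space I)"
    by (rule nn_integral_count_space_nn_integral) (use I in auto)
  also have "\<dots> = (\<integral>\<^sup>+i. emeasure M (X i) \<partial>count_space I)"
    by (intro nn_integral_cong) auto
  finally show ?thesis .
qed

text \<open>
  This is the common source of the two differentiation results: with \<open>M\<close> the Lebesgue measure it gives
  the weak-type bound for the maximal function of \<open>N\<close>, and with the roles exchanged it shows that a
  measure whose density stays bounded along small balls does not charge Lebesgue null sets.
  By Vitali's lemma a disjoint subfamily already covers after enlarging each ball five times.
\<close>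
lemma emeasure_Union_balls_le:
  fixes M N :: "'a::euclidean_space measure"
  assumes M: "sets M = sets borel" and N: "sets N = sets borel" and U: "U \<in> sets borel"
    and F: "\<And>x d. (x, d) \<in> F \<Longrightarrow> 0 < d \<and> d \<le> B \<and> ball x d \<subseteq> U \<and>
              emeasure M (ball x (5 * d)) \<le> c * emeasure N (ball x d)"
  shows "emeasure M (\<Union>(x, d)\<in>F. ball x d) \<le> c * emeasure N U"
proof -
  note [measurable_cong] = M N
  obtain C where C: "countable C" "C \<subseteq> F"
     "pairwise (\<lambda>i j. disjnt (ball (fst i) (snd i)) (ball (fst j) (snd j))) C"
     "(\<Union>i\<in>F. ball (fst i) (snd i)) \<subseteq> (\<Union>i\<in>C. ball (fst i) (5 * snd i))"
    by (rule Vitali_covering_lemma_balls[where K=F and a=fst and r=snd and B=B,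
        OF order_refl]) (use F in force)+
  have "emeasure M (\<Union>(x, d)\<in>F. ball x d) \<le> emeasure M (\<Union>i\<in>C. ball (fst i) (5 * snd i))"
    using C(4) by (intro emeasure_mono) (auto simp: M case_prod_unfold intro!: borel_open)
  also have "\<dots> \<le> (\<integral>\<^sup>+i. emeasure M (ball (fst i) (5 * snd i)) \<partial>count_space C)"
    by (rule emeasure_UN_le_nn_integral) (use C in \<open>auto simp: M\<close>)
  also have "\<dots> \<le> (\<integral>\<^sup>+i. c * emeasure N (ball (fst i) (snd i)) \<partial>count_space C)"
    using C(2) F by (intro nn_integral_mono) auto
  also have "\<dots> = c * (\<integral>\<^sup>+i. emeasure N (ball (fst i) (snd i)) \<partial>count_space C)"
    by (rule nn_integral_cmult) auto
  also have "(\<integral>\<^sup>+i. emeasure N (ball (fst i) (snd i)) \<partial>count_space C)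
      = emeasure N (\<Union>i\<in>C. ball (fst i) (snd i))"
    by (rule emeasure_UN_countable[symmetric])
       (use C in \<open>auto simp: N disjoint_family_on_def pairwise_def disjnt_def\<close>)
  also have "\<dots> \<le> emeasure N U"
    using C(2) F U N by (intro emeasure_mono) force+
  finally show ?thesis by (simp add: mult_left_mono)
qed

section \<open>Two-sided bounds for the Poisson integral\<close>

context circle_measure begin

text \<open>
  At height \<open>1 - r\<close> above the point \<open>x\<close> the Poisson kernel is at least \<open>1 / (4 * (1 - r))\<close> on the ball
  of radius \<open>1 - r\<close>.
\<close>
lemma emeasure_cball_le_poisson:
  assumes x: "norm x = 1" and r: "0 \<le> r" "r < 1"
  shows "emeasure M (cball x (1 - r)) \<le> ennreal (4 * (1 - r)) * poisson M (of_real r * x)"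
proof -
  have "indicator (cball x (1 - r)) w \<le> ennreal (4 * (1 - r)) * ennreal (poisson_kernel w (of_real r * x))"
    if w: "norm w = 1" for w
  proof (cases "w \<in> cball x (1 - r)")
    case True
    define d where "d = norm (w - of_real r * x)"
    have nz: "norm (of_real r * x) = r" using x r by (simp add: norm_mult)
    have "norm (x - of_real r * x) = 1 - r" using x r by (intro norm_radial_diff) auto
    then have "d \<le> 2 * (1 - r)"
      using True norm_triangle_ineq[of "w - x" "x - of_real r * x"]
      by (simp add: d_def dist_norm norm_minus_commute)
    moreover have d: "d \<ge> 1 - r" using norm_diff_ge[OF w, of "of_real r * x"] nz by (simp add: d_def)
    ultimately have "d\<^sup>2 \<le> (2 * (1 - r))\<^sup>2" using r by (intro power_mono) auto
    also have "\<dots> = 4 * (1 - r) * (1 - r) * 1" by (simp add: power2_eq_square algebra_simps)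
    also have "\<dots> \<le> 4 * (1 - r) * (1 - r) * (1 + r)" using r by (intro mult_left_mono) auto
    finally have "1 \<le> 4 * (1 - r) * ((1 - r\<^sup>2) / d\<^sup>2)"
      using r d by (simp add: field_simps power2_eq_square)
    then have "1 \<le> ennreal (4 * (1 - r) * poisson_kernel w (of_real r * x))"
      by (simp add: poisson_kernel_def nz d_def)
    then show ?thesis using True r by (simp add: ennreal_mult')
  qed auto
  then have "AE w in M. indicator (cball x (1 - r)) w
      \<le> ennreal (4 * (1 - r)) * ennreal (poisson_kernel w (of_real r * x))"
    using AE_circle by auto
  then have "(\<integral>\<^sup>+w. indicator (cball x (1 - r)) w \<partial>M)
      \<le> (\<integral>\<^sup>+w. ennreal (4 * (1 - r)) * ennreal (poisson_kernel w (of_real r * x)) \<partial>M)"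
    by (rule nn_integral_mono_AE)
  then show ?thesis by (simp add: poisson_def nn_integral_cmult)
qed

text \<open>
  The Poisson integral is dominated by the maximal function: on the dyadic annulus of radius
  \<open>2 ^ k * (1 - r)\<close> the kernel is of size \<open>4 ^ - k / (1 - r)\<close>, while the measure of that ball is at most
  \<open>t * 2 ^ k * (1 - r)\<close>, so the contributions form a geometric series.
\<close>
lemma poisson_le_of_ball_le:
  assumes x: "norm x = 1" and r: "0 \<le> r" "r < 1"
    and t: "\<And>d. d > 0 \<Longrightarrow> emeasure M (ball x d) \<le> t * ennreal d"
  shows "poisson M (of_real r * x) \<le> 64 * t"
proof -
  define e where "e = 1 - r"
  have e: "e > 0" "e \<le> 1" using r by (auto simp: e_def)
  define a where "a k = 32 / 4 ^ k / e" for k :: nat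
  have a: "a k \<ge> 0" for k using e by (simp add: a_def)
  have nz: "norm (of_real r * x) = r" using x r by (simp add: norm_mult)
  have ker: "ennreal (poisson_kernel w (of_real r * x)) \<le> (\<Sum>k. ennreal (a k) * indicator (ball x (2 ^ k * e)) w)"
    if w: "norm w = 1" for w
  proof -
    define d where "d = norm (w - of_real r * x)"
    have "norm (x - of_real r * x) = e" using norm_radial_diff[of x r] x e by (simp add: e_def)
    then have tri: "norm (w - x) \<le> d + e"
      using norm_triangle_ineq4[of "w - of_real r * x" "x - of_real r * x"] by (simp add: d_def)
    have d: "d \<ge> e" using norm_diff_ge[OF w, of "of_real r * x"] nz by (simp add: d_def e_def)
    obtain k0 where "norm (w - x) / e < 2 ^ k0"
      using real_arch_pow[of 2] by auto
    then have k0: "norm (w - x) < 2 ^ k0 * e" using e by (simp add: field_simps)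
    \<comment> \<open>the smallest dyadic ball around \<open>x\<close> that contains \<open>w\<close>\<close>
    define k where "k = (LEAST k. norm (w - x) < 2 ^ k * e)"
    have k: "norm (w - x) < 2 ^ k * e" unfolding k_def using k0 by (rule LeastI)
    have "1 - r\<^sup>2 = e * (2 - e)" by (simp add: e_def power2_eq_square algebra_simps)
    also have "\<dots> \<le> e * 2" using e by (intro mult_left_mono) auto
    finally have num: "1 - r\<^sup>2 \<le> 2 * e" by simp
    have "(1 - r\<^sup>2) / d\<^sup>2 \<le> a k"
    proof (cases k)
      case 0
      have "(1 - r\<^sup>2) / d\<^sup>2 \<le> (2 * e) / e\<^sup>2"
        using num d e by (intro frac_le power_mono) auto
      also have "\<dots> \<le> a k" using 0 e by (simp add: a_def power2_eq_square field_simps)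
      finally show ?thesis .
    next
      case (Suc j)
      then have "\<not> norm (w - x) < 2 ^ j * e"
        using not_less_Least[of j "\<lambda>k. norm (w - x) < 2 ^ k * e"] by (simp add: k_def)
      then have "2 ^ j * e / 2 \<le> d" using tri d by simp
      then have "(1 - r\<^sup>2) / d\<^sup>2 \<le> (2 * e) / (2 ^ j * e / 2)\<^sup>2"
        using num d e by (intro frac_le power_mono) auto
      also have "\<dots> = a k"
      proof -
        have "(2 ^ j)\<^sup>2 = (4 ^ j :: real)" by (simp add: power2_eq_square flip: power_mult_distrib)
        then show ?thesis using Suc e
          by (simp add: a_def power_divide power_mult_distrib) (simp add: field_simps power2_eq_square)
      qed
      finally show ?thesis .
    qed
    then have "ennreal (poisson_kernel w (of_real r * x)) \<le> ennreal (a k)"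
      by (simp add: poisson_kernel_def nz d_def ennreal_leI)
    also have "\<dots> = ennreal (a k) * indicator (ball x (2 ^ k * e)) w"
      using k by (simp add: dist_norm norm_minus_commute)
    also have "\<dots> \<le> (\<Sum>k. ennreal (a k) * indicator (ball x (2 ^ k * e)) w)"
      using sum_le_suminf[of "\<lambda>k. ennreal (a k) * indicator (ball x (2 ^ k * e)) w" "{k}", OF summableI]
      by (simp del: sum_mult_indicator)
    finally show ?thesis .
  qed
  have "poisson M (of_real r * x) \<le> (\<integral>\<^sup>+w. (\<Sum>k. ennreal (a k) * indicator (ball x (2 ^ k * e)) w) \<partial>M)"
    unfolding poisson_def by (rule nn_integral_mono_AE) (use ker AE_circle in auto)
  also have "\<dots> = (\<Sum>k. \<integral>\<^sup>+w. ennreal (a k) * indicator (ball x (2 ^ k * e)) w \<partial>M)"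
    by (intro nn_integral_suminf borel_measurable_times_ennreal borel_measurable_const
        borel_measurable_indicator) simp
  also have "\<dots> = (\<Sum>k. ennreal (a k) * emeasure M (ball x (2 ^ k * e)))"
    by (subst nn_integral_cmult_indicator) simp_all
  also have "\<dots> \<le> (\<Sum>k. t * ennreal (32 * (1 / 2) ^ k))"
  proof (rule suminf_le)
    fix k
    have "ennreal (a k) * emeasure M (ball x (2 ^ k * e)) \<le> ennreal (a k) * (t * ennreal (2 ^ k * e))"
      using e by (intro mult_left_mono t) auto
    also have "\<dots> = t * ennreal (a k * (2 ^ k * e))"
      using ennreal_mult'[OF a[of k], of "2 ^ k * e"] by (simp add: mult_ac)
    also have "a k * (2 ^ k * e) = 32 * (1 / 2) ^ k"
      using e by (simp add: a_def power_divide field_simps flip: power_mult_distrib)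
    finally show "ennreal (a k) * emeasure M (ball x (2 ^ k * e)) \<le> t * ennreal (32 * (1 / 2) ^ k)" .
  qed auto
  also have "\<dots> = t * (\<Sum>k. ennreal (32 * (1 / 2) ^ k))" by (rule ennreal_suminf_cmult)
  also have "(\<Sum>k. ennreal (32 * (1 / 2) ^ k)) = ennreal 64"
    using geometric_sums[of "1/2::real", THEN sums_mult[of _ _ 32]] by (intro suminf_ennreal_eq) auto
  finally show ?thesis by (simp add: mult.commute)
qed

lemma poisson_tendsto_0_away:
  assumes x: "norm x = 1" and K: "closed K" "x \<notin> K" "AE w in M. w \<in> K"
  shows "((\<lambda>r. poisson M (of_real r * x)) \<longlongrightarrow> 0) (at_left 1)"
proof -
  obtain d where d: "d > 0" "\<And>w. w \<in> K \<Longrightarrow> d \<le> dist x w"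
    using separate_point_closed[OF K(1,2)] by auto
  define B where "B r = measure M UNIV * ((1 - r\<^sup>2) / (d / 2)\<^sup>2)" for r
  have ev: "\<forall>\<^sub>F r in at_left 1. max 0 (1 - d / 2) < r \<and> r < (1::real)"
    using eventually_at_left_real[of "max 0 (1 - d / 2)" 1] d(1) by auto
  have "((\<lambda>r. ennreal (B r)) \<longlongrightarrow> ennreal (B 1)) (at_left 1)"
    unfolding B_def using d(1) by (intro tendsto_ennrealI tendsto_intros) auto
  then have lim: "((\<lambda>r. ennreal (B r)) \<longlongrightarrow> 0) (at_left 1)" by (simp add: B_def)
  show ?thesis
  proof (rule tendsto_sandwich[OF _ _ tendsto_const lim])
    show "\<forall>\<^sub>F r in at_left 1. poisson M (of_real r * x) \<le> ennreal (B r)"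
      using ev
    proof eventually_elim
      case (elim r)
      have nz: "norm (of_real r * x) = r" using x elim by (simp add: norm_mult)
      have xr: "norm (x - of_real r * x) = 1 - r" using x elim by (intro norm_radial_diff) auto
      have "poisson_kernel w (of_real r * x) \<le> (1 - r\<^sup>2) / (d / 2)\<^sup>2" if "w \<in> K" for w
      proof -
        have "norm (x - w) \<le> norm (x - of_real r * x) + norm (w - of_real r * x)"
          using norm_triangle_ineq4[of "x - of_real r * x" "w - of_real r * x"] by simp
        then have "d / 2 \<le> norm (w - of_real r * x)"
          using d(2)[OF that] xr elim by (simp add: dist_norm)
        then show ?thesis unfolding poisson_kernel_def nz
          using d(1) elim by (intro frac_le power_mono) (auto simp: abs_square_le_1)
      qed
      then have "poisson M (of_real r * x) \<le> (\<integral>\<^sup>+w. ennreal ((1 - r\<^sup>2) / (d / 2)\<^sup>2) \<partial>M)"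
        unfolding poisson_def using K(3) by (intro nn_integral_mono_AE) (auto intro!: ennreal_leI)
      also have "\<dots> = ennreal (B r)"
        using elim by (simp add: B_def emeasure_eq_measure ennreal_mult'[symmetric] abs_square_le_1 mult.commute)
      finally show ?case .
    qed
  qed auto
qed

end

section \<open>The Schwarz integral formula\<close>


lemma has_integral_circle_Cauchy:
  fixes g :: "complex \<Rightarrow> complex"
  assumes "continuous_on (cball 0 1) g" "g holomorphic_on ball 0 1" "norm z < 1"
  shows "((\<lambda>t. cis t / (cis t - z) * g (cis t)) has_integral 2 * pi * g z) {0..2*pi}"
proof -
  have "((\<lambda>u. g u / (u - z)) has_contour_integral 2 * of_real pi * \<i> * g z) (part_circlepath 0 1 0 (2 * pi))"
    using Cauchy_integral_circlepath[OF assms(1,2), of z] assms(3) by (simp add: circlepath_def)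
  then have "((\<lambda>t. g (cis t) / (cis t - z) * \<i> * cis t) has_integral 2 * of_real pi * \<i> * g z) {0..2*pi}"
    by (subst (asm) has_contour_integral_part_circlepath_iff) (auto simp: mult_ac)
  then have "((\<lambda>t. (- \<i>) * (g (cis t) / (cis t - z) * \<i> * cis t)) has_integral (- \<i>) * (2 * of_real pi * \<i> * g z)) {0..2*pi}"
    by (rule has_integral_mult_right)
  then show ?thesis by (simp add: mult_ac)
qed

lemma schwarz_kernel_eq:
  assumes "norm w = 1" "norm z < 1"
  shows "schwarz_kernel w z = 2 * (w / (w - z)) - 1"
proof -
  have ne: "w - z \<noteq> 0" using assms by auto
  have "cnj w * w = 1"
    using assms by (simp add: complex_norm_square[symmetric] mult.commute)
  then have "1 - cnj w * z = cnj w * (w - z)" "1 + cnj w * z = cnj w * (w + z)"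
    by (simp_all add: algebra_simps)
  moreover have "cnj w \<noteq> 0" using assms by auto
  ultimately have "schwarz_kernel w z = (w + z) / (w - z)"
    by (simp add: schwarz_kernel_def)
  then show ?thesis using ne by (simp add: field_simps)
qed

text \<open>
  Write the real part as half of \<open>g + cnj g\<close>. Cauchy's formula turns the first summand into
  \<open>2 * g z - g 0\<close>. For the second, the conjugate kernel \<open>(1 + cnj z * w) / (1 - cnj z * w)\<close> is holomorphic
  in \<open>w\<close>, so the mean value property evaluates the integral at the origin.
\<close>
lemma has_integral_schwarz_Re:
  fixes g :: "complex \<Rightarrow> complex"
  assumes g: "continuous_on (cball 0 1) g" "g holomorphic_on ball 0 1" and z: "norm z < 1"
  shows "((\<lambda>t. schwarz_kernel (cis t) z * of_real (Re (g (cis t)))) has_integral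
           2 * pi * (g z - \<i> * Im (g 0))) {0..2*pi}"
proof -
  have mv: "((\<lambda>t. f (cis t)) has_integral 2 * pi * f 0) {0..2*pi}"
    if "continuous_on (cball 0 1) f" "f holomorphic_on ball 0 1"
    for f :: "complex \<Rightarrow> complex"
    using has_integral_circle_Cauchy[OF that, of 0] by simp
  have "((\<lambda>t. 2 * (cis t / (cis t - z) * g (cis t)) - g (cis t)) has_integral
      2 * (2 * pi * g z) - 2 * pi * g 0) {0..2*pi}"
    by (intro has_integral_diff has_integral_mult_right has_integral_circle_Cauchy mv g z)
  then have 1: "((\<lambda>t. schwarz_kernel (cis t) z * g (cis t)) has_integral
      2 * (2 * pi * g z) - 2 * pi * g 0) {0..2*pi}"
    using z by (subst (asm) has_integral_cong[where g="\<lambda>t. schwarz_kernel (cis t) z * g (cis t)"])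
      (auto simp: schwarz_kernel_eq ring_distribs)
  have ne: "1 - cnj z * w \<noteq> 0" if "norm w \<le> 1" for w
  proof
    assume "1 - cnj z * w = 0"
    then have "norm (cnj z * w) = 1" by (metis eq_iff_diff_eq_0 norm_one)
    moreover have "norm z * norm w \<le> norm z * 1" using that by (intro mult_left_mono) auto
    ultimately show False using z by (simp add: norm_mult)
  qed
  have "((\<lambda>t. (1 + cnj z * cis t) / (1 - cnj z * cis t) * g (cis t)) has_integral
     2 * pi * ((1 + cnj z * 0) / (1 - cnj z * 0) * g 0)) {0..2*pi}"
    by (rule mv[where f="\<lambda>w. (1 + cnj z * w) / (1 - cnj z * w) * g w"])
       (use ne in \<open>auto intro!: continuous_intros holomorphic_intros g\<close>)
  from has_integral_linear[OF this bounded_linear_cnj]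
  have 2: "((\<lambda>t. schwarz_kernel (cis t) z * cnj (g (cis t))) has_integral 2 * pi * cnj (g 0)) {0..2*pi}"
    by (simp add: o_def schwarz_kernel_def mult.commute)
  have "((\<lambda>t. (schwarz_kernel (cis t) z * g (cis t) + schwarz_kernel (cis t) z * cnj (g (cis t))) / 2) has_integral
     (2 * (2 * pi * g z) - 2 * pi * g 0 + 2 * pi * cnj (g 0)) / 2) {0..2*pi}"
    by (intro has_integral_divide has_integral_add 1 2)
  moreover have "(schwarz_kernel (cis t) z * g (cis t) + schwarz_kernel (cis t) z * cnj (g (cis t))) / 2
    = schwarz_kernel (cis t) z * of_real (Re (g (cis t)))" for t
    by (simp add: complex_add_cnj flip: distrib_left)
  moreover have "(2 * (2 * pi * g z) - 2 * pi * g 0 + 2 * pi * cnj (g 0)) / 2 = 2 * pi * (g z - \<i> * Im (g 0))"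
    by (simp add: complex_eq_iff field_simps)
  ultimately show ?thesis by (simp only: of_real_mult of_real_numeral)
qed

lemma continuous_on_schwarz_kernel_cis:
  assumes z: "norm z < 1"
  shows "continuous_on A (\<lambda>t. schwarz_kernel (cis t) z)"
proof -
  have "1 - cis (- t) * z \<noteq> 0" for t
  proof
    assume "1 - cis (- t) * z = 0"
    then have "norm (cis (- t) * z) = 1" by (metis eq_iff_diff_eq_0 norm_one)
    then show False using z by (simp add: norm_mult)
  qed
  then show ?thesis unfolding schwarz_kernel_def cis_cnj by (intro continuous_intros) auto
qed

section \<open>Normalized Lebesgue measure on the circle\<close>

definition circle_uniform :: "complex measure" where
  "circle_uniform = distr (uniform_measure lborel {0..<2 * pi}) borel cis"

lemma cis_measurable [measurable]: "cis \<in> borel_measurable borel"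
  by (intro borel_measurable_continuous_onI continuous_intros)

lemma uniform_measure_eq_density:
  "uniform_measure lborel {0..<2 * pi} = density lborel (\<lambda>t. ennreal (indicator {0..<2 * pi} t / (2 * pi)))"
  unfolding uniform_measure_def
proof (rule arg_cong[where f="density lborel"], rule ext)
  fix t :: real
  show "indicator {0..<2 * pi} t / emeasure lborel {0..<2 * pi} = ennreal (indicator {0..<2 * pi} t / (2 * pi))"
    using divide_ennreal[of 1 "2 * pi"] by (cases "t \<in> {0..<2 * pi}") simp_all
qed

interpretation circle_uniform: circle_measure circle_uniform
proof -
  interpret prob_space "uniform_measure lborel {0..<2 * pi}"
    by (rule prob_space_uniform_measure) auto
  interpret D: prob_space circle_uniform
    unfolding circle_uniform_def by (rule prob_space_distr) simp
  show "circle_measure circle_uniform"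
  proof (intro circle_measure.intro circle_measure_axioms.intro)
    show "finite_measure circle_uniform" by (rule D.finite_measure_axioms)
    show "sets circle_uniform = sets borel" by (simp add: circle_uniform_def)
    have "{w::complex. norm w = 1} \<in> sets borel"
      by (intro borel_closed closed_Collect_eq continuous_intros)
    then show "AE w in circle_uniform. norm w = 1"
      unfolding circle_uniform_def by (subst AE_distr_iff) auto
  qed
qed

lemma emeasure_circle_uniform_UNIV: "emeasure circle_uniform UNIV = 1"
proof -
  interpret prob_space "uniform_measure lborel {0..<2 * pi}"
    by (rule prob_space_uniform_measure) auto
  interpret D: prob_space circle_uniform
    unfolding circle_uniform_def by (rule prob_space_distr) simp
  show ?thesis using D.emeasure_space_1 by simp
qed

lemma integral_circle_uniform:
  fixes f :: "complex \<Rightarrow> complex" and I :: complex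
  assumes [measurable]: "f \<in> borel_measurable borel"
    and cont: "continuous_on {0..2*pi} (\<lambda>t. f (cis t))"
    and int: "((\<lambda>t. f (cis t)) has_integral 2 * pi * I) {0..2*pi}"
  shows "(\<integral>w. f w \<partial>circle_uniform) = I"
proof -
  have "(\<integral>w. f w \<partial>circle_uniform) = (\<integral>t. f (cis t) \<partial>uniform_measure lborel {0..<2 * pi})"
    unfolding circle_uniform_def by (rule integral_distr) auto
  also have "\<dots> = (\<integral>t. (indicator {0..<2 * pi} t / (2 * pi)) *\<^sub>R f (cis t) \<partial>lborel)"
    unfolding uniform_measure_eq_density by (rule integral_density) auto
  also have "\<dots> = (\<integral>t. (1 / (2 * pi)) *\<^sub>R (indicator {0..2 * pi} t *\<^sub>R f (cis t)) \<partial>lborel)"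
    by (intro integral_cong_AE)
       (use AE_lborel_singleton[of "2 * pi"] in \<open>auto simp: indicator_def\<close>)
  also have "\<dots> = (1 / (2 * pi)) *\<^sub>R (LINT t:{0..2*pi}|lborel. f (cis t))"
    unfolding set_lebesgue_integral_def by (rule integral_scaleR_right)
  also have "(LINT t:{0..2*pi}|lborel. f (cis t)) = integral {0..2*pi} (\<lambda>t. f (cis t))"
    by (intro set_borel_integral_eq_integral borel_integrable_atLeastAtMost' cont)
  also have "\<dots> = 2 * pi * I" using int by (rule integral_unique)
  finally show ?thesis by (simp add: scaleR_conv_of_real)
qed

lemma Q_circle_uniform:
  assumes z: "norm z < 1"
  shows "Q circle_uniform z = 1"
proof -
  show ?thesis
    unfolding circle_uniform.Q_altdef
    using has_integral_schwarz_Re[of "\<lambda>_. 1", OF _ _ z] continuous_on_schwarz_kernel_cis[OF z]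
    by (subst integral_circle_uniform[where I=1]) auto
qed

lemma poisson_circle_uniform: "norm z < 1 \<Longrightarrow> poisson circle_uniform z = 1"
  by (simp add: circle_uniform.poisson_eq Q_circle_uniform)

text \<open>
  The Poisson integral of Lebesgue measure is identically 1, so the lower bound for Poisson integrals
  bounds the measure of balls from above.
\<close>
lemma emeasure_circle_uniform_ball_le:
  assumes x: "norm x = 1" and d: "d > 0"
  shows "emeasure circle_uniform (ball x d) \<le> ennreal (4 * d)"
proof (cases "d \<le> 1")
  case True
  have "emeasure circle_uniform (ball x d) \<le> emeasure circle_uniform (cball x (1 - (1 - d)))"
    by (intro emeasure_mono) auto
  also have "\<dots> \<le> ennreal (4 * (1 - (1 - d))) * poisson circle_uniform (of_real (1 - d) * x)"
    using True d by (intro circle_uniform.emeasure_cball_le_poisson x) auto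
  also have "poisson circle_uniform (of_real (1 - d) * x) = 1"
    using True d x by (intro poisson_circle_uniform) (auto simp: norm_mult simp del: of_real_diff)
  finally show ?thesis by simp
next
  case False
  have "emeasure circle_uniform (ball x d) \<le> emeasure circle_uniform UNIV"
    by (intro emeasure_mono) auto
  also have "\<dots> = ennreal 1" by (simp add: emeasure_circle_uniform_UNIV)
  also have "\<dots> \<le> ennreal (4 * d)" using False by (intro ennreal_leI) auto
  finally show ?thesis .
qed

lemma norm_cis_diff_squared: "(norm (cis a - cis b))\<^sup>2 = (2 * sin ((a - b) / 2))\<^sup>2"
proof -
  have "cis a - cis b = cis b * (cis (a - b) - 1)"
    by (simp add: cis_mult algebra_simps)
  then have "(norm (cis a - cis b))\<^sup>2 = (norm (cis (a - b) - 1))\<^sup>2" by (simp add: norm_mult)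
  moreover have "cos (a - b) = 1 - 2 * (sin ((a - b) / 2))\<^sup>2"
    using cos_double_sin[of "(a - b) / 2"] by (simp only: times_divide_eq_right nonzero_mult_div_cancel_left zero_neq_numeral not_False_eq_True)
  moreover have "(norm (cis (a - b) - 1))\<^sup>2 = 2 - 2 * cos (a - b)"
    using sin_cos_squared_add[of "a - b"]
    unfolding cmod_power2 by (simp add: power2_eq_square algebra_simps)
  ultimately show ?thesis by (simp add: power_mult_distrib)
qed

lemma norm_cis_diff_le: "norm (cis a - cis b) \<le> \<bar>a - b\<bar>"
proof -
  have "(2 * sin ((a - b) / 2))\<^sup>2 \<le> \<bar>a - b\<bar>\<^sup>2"
    using abs_sin_x_le_abs_x[of "(a - b) / 2"]
    by (intro abs_le_square_iff[THEN iffD1]) (simp add: abs_mult)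
  then have "(norm (cis a - cis b))\<^sup>2 \<le> \<bar>a - b\<bar>\<^sup>2" by (simp only: norm_cis_diff_squared)
  then show ?thesis by (rule power2_le_imp_le) simp
qed

lemma emeasure_circle_uniform_ball_ge:
  assumes x: "norm x = 1" and d: "0 < d" "d \<le> 1"
  shows "ennreal d \<le> ennreal (2 * pi) * emeasure circle_uniform (ball x d)"
proof -
  obtain a where a: "0 \<le> a" "a < 2 * pi" "x = cis a"
    using Arg2pi_ge_0[of x] Arg2pi_lt_2pi[of x] Arg2pi_eq[of x] x by (auto simp: cis_conv_exp)
  \<comment> \<open>an interval of length \<open>d\<close> inside \<open>[0, 2 * pi]\<close> with the angle of \<open>x\<close> as an endpoint\<close>
  define l where "l = (if a < pi then a else a - d)"
  have l: "0 \<le> l" "l + d \<le> 2 * pi" "l \<le> a" "a \<le> l + d"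
    using a d pi_gt3 by (auto simp: l_def)
  have "ennreal d = emeasure lborel {l<..<l + d}" using d by simp
  also have "\<dots> \<le> emeasure lborel ({0..<2 * pi} \<inter> cis -` ball x d)"
  proof (rule emeasure_mono)
    show "{l<..<l + d} \<subseteq> {0..<2 * pi} \<inter> cis -` ball x d"
    proof
      fix t assume t: "t \<in> {l<..<l + d}"
      then have "\<bar>a - t\<bar> < d" using l by (auto simp: l_def split: if_splits)
      then show "t \<in> {0..<2 * pi} \<inter> cis -` ball x d"
        using t l norm_cis_diff_le[of a t] a by (auto simp: dist_norm)
    qed
  qed (use measurable_sets_borel[OF cis_measurable] in auto)
  also have "\<dots> = ennreal (2 * pi) * emeasure circle_uniform (ball x d)"
  proof -
    have "emeasure circle_uniform (ball x d) = emeasure lborel ({0..<2 * pi} \<inter> cis -` ball x d) / ennreal (2 * pi)"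
      by (simp add: circle_uniform_def emeasure_distr measurable_sets_borel[OF cis_measurable])
    then show ?thesis
      using ennreal_mult_divide_eq[of "ennreal (2 * pi)" "emeasure lborel ({0..<2 * pi} \<inter> cis -` ball x d)"]
      by (simp add: ennreal_times_divide) (simp add: mult.commute)
  qed
  finally show ?thesis .
qed

section \<open>Boundary limits of Poisson integrals\<close>

text \<open>
  Exceptional sets below are not known to be measurable; it is enough to cover them by measurable
  sets of arbitrarily small measure.
\<close>
lemma AE_I_small_cover:
  assumes "\<And>e. e > 0 \<Longrightarrow> \<exists>W\<in>sets M. {x \<in> space M. \<not> P x} \<subseteq> W \<and> emeasure M W \<le> ennreal e"
  shows "AE x in M. P x"
proof -
  have "\<forall>n::nat. \<exists>W\<in>sets M. {x \<in> space M. \<not> P x} \<subseteq> W \<and> emeasure M W \<le> ennreal (1 / Suc n)"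
    using assms by auto
  then obtain W where W: "\<And>n. W n \<in> sets M" "\<And>n. {x \<in> space M. \<not> P x} \<subseteq> W n"
    "\<And>n. emeasure M (W n) \<le> ennreal (1 / Suc n)" by metis
  have le: "emeasure M (\<Inter>n. W n) \<le> ennreal (1 / Suc n)" for n
    using W(3)[of n] emeasure_mono[of "\<Inter>n. W n" "W n" M] W(1) by (meson INF_lower UNIV_I order_trans)
  have "(\<lambda>n. ennreal (1 / Suc n)) \<longlonglongrightarrow> ennreal 0"
    by (intro tendsto_ennrealI LIMSEQ_Suc lim_1_over_n)
  then have "emeasure M (\<Inter>n. W n) \<le> ennreal 0"
    by (rule LIMSEQ_le_const) (use le in auto)
  then have "(\<Inter>n. W n) \<in> null_sets M" using W(1) by (auto simp: null_sets_def)
  then show ?thesis by (rule AE_I') (use W(2) in auto)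
qed

context circle_measure begin

lemma circle_measure_restrict:
  assumes "K \<in> sets borel"
  shows "circle_measure (density M (indicator K))"
proof -
  have [measurable]: "K \<in> sets borel" by fact
  have "emeasure (density M (indicator K)) UNIV \<le> emeasure M UNIV"
    by (subst emeasure_density) (auto simp: emeasure_restricted intro!: emeasure_mono)
  then interpret finite_measure "density M (indicator K)"
    by (intro finite_measureI) (auto simp: top_unique)
  show ?thesis
    by unfold_locales (use AE_circle in \<open>auto simp: AE_density\<close>)
qed

lemma poisson_split:
  assumes [measurable]: "K \<in> sets borel"
  shows "poisson M z = poisson (density M (indicator K)) z + poisson (density M (indicator (- K))) z"
proof -
  have "poisson M z = (\<integral>\<^sup>+w. indicator K w * ennreal (poisson_kernel w z) + indicator (- K) w * ennreal (poisson_kernel w z) \<partial>M)"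
    unfolding poisson_def by (intro nn_integral_cong) (auto simp: indicator_def)
  also have "\<dots> = poisson (density M (indicator K)) z + poisson (density M (indicator (- K))) z"
    unfolding poisson_def by (subst nn_integral_add) (auto simp: nn_integral_density)
  finally show ?thesis .
qed

text \<open>
  The weak-type estimate for the maximal function; the radii of the relevant balls are bounded because
  \<open>M\<close> is finite.
\<close>
lemma emeasure_circle_uniform_maximal_le:
  assumes t: "t > 0"
  defines "F \<equiv> {(x, d). norm x = 1 \<and> 0 < d \<and> emeasure M (ball x d) > ennreal (t * d)}"
  shows "emeasure circle_uniform (\<Union>(x, d)\<in>F. ball x d) \<le> ennreal (20 / t) * emeasure M UNIV"
proof (rule emeasure_Union_balls_le[where B="measure M UNIV / t"])
  fix x d assume "(x, d) \<in> F"
  then have F: "norm x = 1" "0 < d" "ennreal (t * d) < emeasure M (ball x d)" by (auto simp: F_def)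
  have "ennreal (t * d) < emeasure M UNIV"
    by (rule less_le_trans[OF F(3)]) (auto intro!: emeasure_mono)
  then have "d \<le> measure M UNIV / t"
    using t F by (simp add: emeasure_eq_measure field_simps ennreal_less_iff)
  moreover have "emeasure circle_uniform (ball x (5 * d)) \<le> ennreal (4 * (5 * d))"
    using F by (intro emeasure_circle_uniform_ball_le) auto
  moreover have "ennreal (4 * (5 * d)) = ennreal (20 / t) * ennreal (t * d)"
    using t F by (simp add: ennreal_mult'[symmetric])
  moreover have "\<dots> \<le> ennreal (20 / t) * emeasure M (ball x d)"
    using F by (intro mult_left_mono) auto
  ultimately show "0 < d \<and> d \<le> measure M UNIV / t \<and> ball x d \<subseteq> UNIV \<and>
      emeasure circle_uniform (ball x (5 * d)) \<le> ennreal (20 / t) * emeasure M (ball x d)"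
    using F by auto
qed auto

text \<open>
  Up to a small remainder the measure sits on a compact set \<open>K\<close> disjoint from \<open>A\<close>. The part on \<open>K\<close> has
  vanishing Poisson integral at every point of \<open>A\<close>, and the weak-type estimate makes the remainder small
  outside a small set.
\<close>
lemma AE_poisson_tendsto_0:
  assumes A [measurable]: "A \<in> sets borel" and null: "emeasure M A = 0"
  shows "AE x in circle_uniform. x \<in> A \<longrightarrow> ((\<lambda>r. poisson M (of_real r * x)) \<longlongrightarrow> 0) (at_left 1)"
proof -
  have "AE x in circle_uniform. x \<in> A \<longrightarrow> (\<forall>\<^sub>F r in at_left 1. poisson M (of_real r * x) \<le> ennreal t)"
    if t: "t > 0" for t
  proof -
    define P where "P x \<longleftrightarrow> norm x = 1 \<longrightarrow> x \<in> A \<longrightarrow>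
      (\<forall>\<^sub>F r in at_left 1. poisson M (of_real r * x) \<le> ennreal t)" for x
    have "AE x in circle_uniform. P x"
    proof (rule AE_I_small_cover)
      fix e :: real assume e: "e > 0"
      define s where "s = t / 128"
      have s: "s > 0" using t by (simp add: s_def)
      \<comment> \<open>\<open>s\<close> is chosen so that the maximal bound \<open>64 * s\<close> is \<open>t / 2\<close>, and \<open>e'\<close> so that the weak-type
          estimate produces \<open>e\<close>\<close>
      define e' where "e' = e * s / 20"
      have e': "e' > 0" using e s by (simp add: e'_def)
      have "\<exists>K\<in>{K. K \<subseteq> - A \<and> compact K}. emeasure M (- A) < emeasure M K + ennreal e'"
      proof (rule SUP_approx_ennreal[OF e'])
        show "{K. K \<subseteq> - A \<and> compact K} \<noteq> {}" by (auto intro: exI[of _ "{}"])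
        show "emeasure M (- A) = (SUP K\<in>{K. K \<subseteq> - A \<and> compact K}. emeasure M K)"
          by (rule inner_regular) auto
        show "emeasure M (- A) \<noteq> \<infinity>" by simp
      qed
      then obtain K where K: "K \<subseteq> - A" "compact K" "emeasure M (- A) < emeasure M K + ennreal e'"
        by auto
      have [measurable]: "K \<in> sets borel" using K(2) by (intro borel_closed compact_imp_closed)
      interpret M1: circle_measure "density M (indicator K)" by (rule circle_measure_restrict) simp
      interpret M2: circle_measure "density M (indicator (- K))" by (rule circle_measure_restrict) simp
      have "emeasure M (- K) = emeasure M UNIV - emeasure M K"
        using emeasure_compl[of K M] by (simp add: Compl_eq_Diff_UNIV)
      also have "emeasure M UNIV = emeasure M (- A)"
        using emeasure_Un_null_set[of "- A" M A] null by (simp add: null_sets_def)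
      also have "\<dots> - emeasure M K \<le> ennreal e'"
        using K(3) by (simp add: ennreal_minus_le_iff less_imp_le)
      finally have small: "emeasure (density M (indicator (- K))) UNIV \<le> ennreal e'"
        by (simp add: emeasure_density)
      define F where "F = {(x, d). norm x = 1 \<and> 0 < d \<and> emeasure (density M (indicator (- K))) (ball x d) > ennreal (s * d)}"
      define W where "W = (\<Union>(x, d)\<in>F. ball x d)"
      have "emeasure circle_uniform W \<le> ennreal (20 / s) * ennreal e'"
        unfolding W_def F_def
        by (rule order_trans[OF M2.emeasure_circle_uniform_maximal_le[OF s] mult_left_mono[OF small]]) simp
      also have "\<dots> = ennreal e"
        using s e' by (simp add: ennreal_mult[symmetric] e'_def)
      finally have "emeasure circle_uniform W \<le> ennreal e" .
      moreover have "x \<in> W" if "\<not> P x" for x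
      proof (rule ccontr)
        assume "x \<notin> W"
        have x: "norm x = 1" "x \<in> A" using that by (auto simp: P_def)
        have "emeasure (density M (indicator (- K))) (ball x d) \<le> ennreal s * ennreal d" if "d > 0" for d
        proof (rule ccontr)
          assume "\<not> ?thesis"
          then have "(x, d) \<in> F" using x s that by (simp add: F_def not_le ennreal_mult)
          then have "x \<in> W" using that by (auto simp: W_def intro!: bexI[of _ "(x, d)"])
          then show False using \<open>x \<notin> W\<close> by simp
        qed
        then have 2: "poisson (density M (indicator (- K))) (of_real r * x) \<le> ennreal (t / 2)" if "0 \<le> r" "r < 1" for r
          using M2.poisson_le_of_ball_le[OF x(1) that, of "ennreal s"] s
          by (simp add: s_def ennreal_mult'[symmetric] flip: ennreal_numeral)
        have "((\<lambda>r. poisson (density M (indicator K)) (of_real r * x)) \<longlongrightarrow> 0) (at_left 1)"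
          by (rule M1.poisson_tendsto_0_away[OF x(1), of K])
            (use K x in \<open>auto intro: compact_imp_closed simp: AE_density indicator_def\<close>)
        then have "\<forall>\<^sub>F r in at_left 1. poisson (density M (indicator K)) (of_real r * x) < ennreal (t / 2)"
          using t by (intro order_tendstoD(2)) auto
        moreover have "\<forall>\<^sub>F r in at_left 1. 0 < r \<and> r < (1::real)"
          using eventually_at_left_real[of 0 1] by simp
        ultimately have "\<forall>\<^sub>F r in at_left 1. poisson M (of_real r * x) \<le> ennreal t"
        proof eventually_elim
          case (elim r)
          have "poisson M (of_real r * x) \<le> ennreal (t / 2) + ennreal (t / 2)"
            unfolding poisson_split[OF \<open>K \<in> sets borel\<close>]
            using elim 2[of r] by (intro add_mono) auto
          then show ?case using t by (simp flip: ennreal_plus)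
        qed
        then show False using that by (simp add: P_def)
      qed
      moreover have "open W" unfolding W_def by auto
      ultimately show "\<exists>W\<in>sets circle_uniform. {x \<in> space circle_uniform. \<not> P x} \<subseteq> W \<and>
          emeasure circle_uniform W \<le> ennreal e"
        by (intro bexI[of _ W]) auto
    qed
    then show ?thesis using circle_uniform.AE_circle by eventually_elim (simp add: P_def)
  qed
  then have "AE x in circle_uniform. \<forall>n::nat. x \<in> A \<longrightarrow>
      (\<forall>\<^sub>F r in at_left 1. poisson M (of_real r * x) \<le> ennreal (1 / Suc n))"
    by (subst AE_all_countable) auto
  then show ?thesis
  proof eventually_elim
    case (elim x)
    show ?case
    proof
      assume x: "x \<in> A"
      show "((\<lambda>r. poisson M (of_real r * x)) \<longlongrightarrow> 0) (at_left 1)"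
      proof (rule order_tendstoI)
        fix a :: ennreal assume "0 < a"
        then obtain b where b: "0 < b" "ennreal b < a"
          by (metis ennreal_rat_dense ennreal_less_zero_iff)
        obtain n where "1 / Suc n < b" using reals_Archimedean[OF b(1)] by (auto simp: divide_inverse)
        then have n: "ennreal (1 / Suc n) < a"
          using b(2) by (meson ennreal_leI le_less_trans less_imp_le)
        have "\<forall>\<^sub>F r in at_left 1. poisson M (of_real r * x) \<le> ennreal (1 / Suc n)" using elim x by blast
        then show "\<forall>\<^sub>F r in at_left 1. poisson M (of_real r * x) < a"
          by eventually_elim (rule le_less_trans[OF _ n])
      qed simp
    qed
  qed
qed

text \<open>
  Where the Poisson integral does not tend to infinity, arbitrarily small balls have \<open>M\<close>-measure at most
  a constant times their Lebesgue measure. The covering inequality, applied inside an open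
  neighbourhood of \<open>Z\<close> of small Lebesgue measure, shows that such points form an \<open>M\<close>-null set.
\<close>
lemma AE_poisson_tendsto_top:
  assumes Z: "Z \<in> null_sets circle_uniform"
  shows "AE x in M. x \<in> Z \<longrightarrow> ((\<lambda>r. poisson M (of_real r * x)) \<longlongrightarrow> \<top>) (at_left 1)"
proof -
  have Zb [measurable]: "Z \<in> sets borel" using Z by (auto simp: null_sets_def)
  have "AE x in M. x \<in> Z \<longrightarrow> (\<forall>\<^sub>F r in at_left 1. ennreal t < poisson M (of_real r * x))"
    if t: "t > 0" for t
  proof -
    define P where "P x \<longleftrightarrow> norm x = 1 \<longrightarrow> x \<in> Z \<longrightarrow>
      (\<forall>\<^sub>F r in at_left 1. ennreal t < poisson M (of_real r * x))" for x
    have "AE x in M. P x"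
    proof (rule AE_I_small_cover)
      fix e :: real assume e: "e > 0"
      define c where "c = 20 * t * (2 * pi)"
      have c: "c > 0" using t by (simp add: c_def)
      have "emeasure circle_uniform Z = (INF U\<in>{U. Z \<subseteq> U \<and> open U}. emeasure circle_uniform U)"
        by (rule outer_regular) auto
      then have "(INF U\<in>{U. Z \<subseteq> U \<and> open U}. emeasure circle_uniform U) < ennreal (e / c)"
        using Z e c by (auto simp: null_sets_def)
      then obtain U where U: "Z \<subseteq> U" "open U" "emeasure circle_uniform U < ennreal (e / c)"
        by (auto simp: INF_less_iff)
      define F where "F = {(x, d). norm x = 1 \<and> 0 < d \<and> d \<le> 1 \<and> ball x d \<subseteq> U \<and>
        emeasure M (ball x (5 * d)) \<le> ennreal c * emeasure circle_uniform (ball x d)}"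
      define W where "W = (\<Union>(x, d)\<in>F. ball x d)"
      have "emeasure M W \<le> ennreal c * emeasure circle_uniform U"
        unfolding W_def by (rule emeasure_Union_balls_le[where B=1]) (use U in \<open>auto simp: F_def\<close>)
      also have "\<dots> \<le> ennreal c * ennreal (e / c)" using U by (intro mult_left_mono) auto
      also have "\<dots> = ennreal e" using c e by (simp add: ennreal_mult[symmetric])
      finally have "emeasure M W \<le> ennreal e" .
      moreover have "x \<in> W" if "\<not> P x" for x
      proof -
        have x: "norm x = 1" "x \<in> Z"
          and fr: "\<exists>\<^sub>F r in at_left 1. poisson M (of_real r * x) \<le> ennreal t"
          using that by (auto simp: P_def frequently_def not_le)
        obtain \<rho> where \<rho>: "\<rho> > 0" "ball x \<rho> \<subseteq> U"
          using U x by (meson open_contains_ball subsetD)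
        have "\<forall>\<^sub>F r in at_left 1. max 0 (1 - \<rho>) < r \<and> r < (1::real)"
          using eventually_at_left_real[of "max 0 (1 - \<rho>)" 1] \<rho> by simp
        from frequently_eventually_frequently[OF fr this]
        obtain r where r: "poisson M (of_real r * x) \<le> ennreal t" "0 < r" "1 - \<rho> < r" "r < 1"
          by (auto dest: frequently_ex)
        define d where "d = (1 - r) / 5"
        have d: "0 < d" "d \<le> 1" "5 * d = 1 - r" using r by (auto simp: d_def)
        have "emeasure M (ball x (5 * d)) \<le> emeasure M (cball x (1 - r))"
          unfolding d(3) by (intro emeasure_mono) auto
        also have "\<dots> \<le> ennreal (4 * (1 - r)) * poisson M (of_real r * x)"
          using r by (intro emeasure_cball_le_poisson x) auto
        also have "\<dots> \<le> ennreal (20 * d) * ennreal t"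
          using r d by (intro mult_mono) auto
        also have "\<dots> = ennreal (20 * t) * ennreal d"
          using d t by (simp add: ennreal_mult[symmetric] mult_ac)
        also have "\<dots> \<le> ennreal (20 * t) * (ennreal (2 * pi) * emeasure circle_uniform (ball x d))"
          by (intro mult_left_mono emeasure_circle_uniform_ball_ge x d) simp
        also have "\<dots> = ennreal c * emeasure circle_uniform (ball x d)"
        proof -
          have "ennreal c = ennreal (20 * t) * ennreal (2 * pi)"
            unfolding c_def using t by (intro ennreal_mult) auto
          then show ?thesis by (simp add: mult.assoc)
        qed
        finally have "(x, d) \<in> F" using x d \<rho> r by (auto simp: F_def)
        then show ?thesis using d by (auto simp: W_def intro!: bexI[of _ "(x, d)"])
      qed
      moreover have "open W" unfolding W_def by auto
      ultimately show "\<exists>W\<in>sets M. {x \<in> space M. \<not> P x} \<subseteq> W \<and> emeasure M W \<le> ennreal e"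
        by (intro bexI[of _ W]) auto
    qed
    then show ?thesis using AE_circle by eventually_elim (simp add: P_def)
  qed
  then have "AE x in M. \<forall>n::nat. x \<in> Z \<longrightarrow>
      (\<forall>\<^sub>F r in at_left 1. ennreal (Suc n) < poisson M (of_real r * x))"
    by (subst AE_all_countable) (auto simp del: of_nat_Suc)
  then show ?thesis
  proof eventually_elim
    case (elim x)
    show ?case
    proof
      assume x: "x \<in> Z"
      show "((\<lambda>r. poisson M (of_real r * x)) \<longlongrightarrow> \<top>) (at_left 1)"
      proof (rule order_tendstoI)
        fix a :: ennreal assume "a < \<top>"
        then obtain b where b: "0 \<le> b" "a = ennreal b" by (cases a) auto
        obtain n :: nat where "b \<le> n" using real_arch_simple by blast
        then have n: "a \<le> ennreal (Suc n)" unfolding b(2) by (intro ennreal_leI) simp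
        have "\<forall>\<^sub>F r in at_left 1. ennreal (Suc n) < poisson M (of_real r * x)" using elim x by blast
        then show "\<forall>\<^sub>F r in at_left 1. a < poisson M (of_real r * x)"
          by eventually_elim (rule le_less_trans[OF n])
      qed simp
    qed
  qed
qed

end

lemma density_circle_uniform_finite:
  assumes "f \<in> borel_measurable borel" "(\<integral>\<^sup>+w. f w \<partial>circle_uniform) < \<infinity>"
  shows "circle_measure (density circle_uniform f)"
proof -
  have [measurable]: "f \<in> borel_measurable borel" by fact
  interpret finite_measure "density circle_uniform f"
    by (rule finite_measureI) (use assms in \<open>auto simp: emeasure_density\<close>)
  show ?thesis
    by unfold_locales (use circle_uniform.AE_circle in \<open>auto simp: AE_density\<close>)
qed

text \<open>
  For each rational \<open>q\<close> compare \<open>f\<close> with the constant \<open>q\<close>, whose Poisson integral is \<open>q\<close>. Since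
  \<open>f \<le> q + (f - q)\<close> with truncated subtraction, and \<open>f - q\<close> vanishes where \<open>f \<le> q\<close>, the Poisson
  integral of \<open>f\<close> is asymptotically at most \<open>q\<close> almost everywhere on that set; the lower bound is
  symmetric.
\<close>
lemma AE_poisson_density_tendsto:
  assumes f [measurable]: "f \<in> borel_measurable borel" and fin: "(\<integral>\<^sup>+w. f w \<partial>circle_uniform) < \<infinity>"
  shows "AE x in circle_uniform.
    ((\<lambda>r. poisson (density circle_uniform f) (of_real r * x)) \<longlongrightarrow> f x) (at_left 1)"
proof -
  let ?U = circle_uniform
  let ?P = "\<lambda>f x r. poisson (density circle_uniform f) (of_real r * x)"
  have P1: "poisson (density ?U (\<lambda>_. c)) z = c" if "norm z < 1" for c z
    using poisson_circle_uniform[OF that] by (simp add: poisson_def nn_integral_density nn_integral_cmult)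
  have le: "poisson (density ?U f) z \<le> poisson (density ?U g) z + poisson (density ?U h) z"
    if [measurable]: "f \<in> borel_measurable borel" "g \<in> borel_measurable borel" "h \<in> borel_measurable borel"
      and "\<And>w. f w \<le> g w + h w" for f g h z
  proof -
    have "poisson (density ?U f) z = (\<integral>\<^sup>+w. f w * ennreal (poisson_kernel w z) \<partial>?U)"
      by (simp add: poisson_def nn_integral_density)
    also have "\<dots> \<le> (\<integral>\<^sup>+w. g w * ennreal (poisson_kernel w z) + h w * ennreal (poisson_kernel w z) \<partial>?U)"
      using that(4) by (intro nn_integral_mono) (simp add: distrib_right[symmetric] mult_right_mono)
    also have "\<dots> = poisson (density ?U g) z + poisson (density ?U h) z"
      by (simp add: poisson_def nn_integral_density nn_integral_add)
    finally show ?thesis .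
  qed
  have split: "a \<le> b + (a - b)" for a b :: ennreal
    using ennreal_minus_le_iff[of a b "a - b"] by simp
  have vanish: "AE x in ?U. g x = 0 \<longrightarrow> (?P g x \<longlongrightarrow> 0) (at_left 1)"
    if [measurable]: "g \<in> borel_measurable borel" and "(\<integral>\<^sup>+w. g w \<partial>?U) < \<infinity>" for g
  proof -
    interpret circle_measure "density ?U g" by (rule density_circle_uniform_finite) fact+
    have "emeasure (density ?U g) {x. g x = 0} = (\<integral>\<^sup>+x. 0 \<partial>?U)"
      by (subst emeasure_density) (auto intro!: nn_integral_cong simp: indicator_def simp del: nn_integral_const)
    then show ?thesis using AE_poisson_tendsto_0[of "{x. g x = 0}"] by simp
  qed
  have up: "AE x in ?U. f x - ennreal q = 0 \<longrightarrow> (?P (\<lambda>x. f x - ennreal q) x \<longlongrightarrow> 0) (at_left 1)" for q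
  proof (rule vanish)
    have "(\<integral>\<^sup>+w. f w - ennreal q \<partial>?U) \<le> (\<integral>\<^sup>+w. f w \<partial>?U)" by (intro nn_integral_mono) simp
    then show "(\<integral>\<^sup>+w. f w - ennreal q \<partial>?U) < \<infinity>" using fin by (rule le_less_trans)
  qed measurable
  have down: "AE x in ?U. ennreal q - f x = 0 \<longrightarrow> (?P (\<lambda>x. ennreal q - f x) x \<longlongrightarrow> 0) (at_left 1)" for q
  proof (rule vanish)
    have "(\<integral>\<^sup>+w. ennreal q - f w \<partial>?U) \<le> (\<integral>\<^sup>+w. ennreal q \<partial>?U)" by (intro nn_integral_mono) simp
    also have "\<dots> < \<infinity>" by (simp add: emeasure_circle_uniform_UNIV)
    finally show "(\<integral>\<^sup>+w. ennreal q - f w \<partial>?U) < \<infinity>" .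
  qed measurable
  have "AE x in ?U. \<forall>q::rat. f x - ennreal (real_of_rat q) = 0 \<longrightarrow>
      (?P (\<lambda>x. f x - ennreal (real_of_rat q)) x \<longlongrightarrow> 0) (at_left 1)"
    by (subst AE_all_countable) (intro allI up)
  moreover have "AE x in ?U. \<forall>q::rat. ennreal (real_of_rat q) - f x = 0 \<longrightarrow>
      (?P (\<lambda>x. ennreal (real_of_rat q) - f x) x \<longlongrightarrow> 0) (at_left 1)"
    by (subst AE_all_countable) (intro allI down)
  ultimately show ?thesis using circle_uniform.AE_circle
  proof eventually_elim
    case (elim x)
    have unit: "\<forall>\<^sub>F r in at_left 1. 0 < r \<and> r < (1::real)"
      using eventually_at_left_real[of 0 1] by simp
    have nz: "norm (of_real r * x) < 1" if "0 < r \<and> r < 1" for r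
      using that elim(3) by (simp add: norm_mult)
    show "(?P f x \<longlongrightarrow> f x) (at_left 1)"
    proof (rule order_tendstoI)
      fix a assume a: "a < f x"
      obtain q where q: "a < ennreal (real_of_rat q)" "ennreal (real_of_rat q) < f x"
        using ennreal_rat_dense[OF a] by auto
      have "ennreal (real_of_rat q) - f x = 0" using q(2) by (simp add: diff_eq_0_iff_ennreal less_imp_le)
      then have "(?P (\<lambda>x. ennreal (real_of_rat q) - f x) x \<longlongrightarrow> 0) (at_left 1)" using elim(2) by blast
      moreover have "0 < ennreal (real_of_rat q) - a" using q(1) by (simp add: diff_gt_0_iff_gt_ennreal)
      ultimately have "\<forall>\<^sub>F r in at_left 1. ?P (\<lambda>x. ennreal (real_of_rat q) - f x) x r < ennreal (real_of_rat q) - a"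
        by (rule order_tendstoD(2))
      then show "\<forall>\<^sub>F r in at_left 1. a < ?P f x r" using unit
      proof eventually_elim
        case (elim r)
        let ?R = "?P (\<lambda>x. ennreal (real_of_rat q) - f x) x r"
        have "?P (\<lambda>_. ennreal (real_of_rat q)) x r \<le> ?P f x r + ?R"
          by (rule le) (simp_all add: split)
        then have *: "ennreal (real_of_rat q) \<le> ?P f x r + ?R" using nz[OF elim(2)] by (simp add: P1)
        show ?case
        proof (rule ccontr)
          assume "\<not> a < ?P f x r"
          then have "ennreal (real_of_rat q) \<le> a + ?R" using * by (meson add_right_mono not_less order_trans)
          then have "ennreal (real_of_rat q) - a \<le> ?R" by (simp add: ennreal_minus_le_iff)
          then show False using elim(1) by simp
        qed
      qed
    next
      fix b assume b: "f x < b"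
      obtain q where q: "f x < ennreal (real_of_rat q)" "ennreal (real_of_rat q) < b"
        using ennreal_rat_dense[OF b] by auto
      have "f x - ennreal (real_of_rat q) = 0" using q(1) less_trans[OF q(1) ennreal_less_top] by (simp add: diff_eq_0_iff_ennreal less_imp_le)
      then have "(?P (\<lambda>x. f x - ennreal (real_of_rat q)) x \<longlongrightarrow> 0) (at_left 1)" using elim(1) by blast
      moreover have "0 < b - ennreal (real_of_rat q)" using q(2) by (simp add: diff_gt_0_iff_gt_ennreal)
      ultimately have "\<forall>\<^sub>F r in at_left 1. ?P (\<lambda>x. f x - ennreal (real_of_rat q)) x r < b - ennreal (real_of_rat q)"
        by (rule order_tendstoD(2))
      then show "\<forall>\<^sub>F r in at_left 1. ?P f x r < b" using unit
      proof eventually_elim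
        case (elim r)
        let ?R = "?P (\<lambda>x. f x - ennreal (real_of_rat q)) x r"
        have "?P f x r \<le> ?P (\<lambda>_. ennreal (real_of_rat q)) x r + ?R"
          by (rule le) (simp_all add: split)
        then have *: "?P f x r \<le> ennreal (real_of_rat q) + ?R" using nz[OF elim(2)] by (simp add: P1)
        show ?case
        proof (rule ccontr)
          assume "\<not> ?P f x r < b"
          then have "b \<le> ennreal (real_of_rat q) + ?R" using * by simp
          then have "b - ennreal (real_of_rat q) \<le> ?R" by (simp add: ennreal_minus_le_iff)
          then show False using elim(1) by simp
        qed
      qed
    qed
  qed
qed

context circle_measure begin

text \<open>
  Here \<open>f\<close> is the density of the absolutely continuous part: the hypothesis says that the decomposition
  of \<open>M\<close> along the null set \<open>Z\<close> and its complement is the Lebesgue decomposition.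
\<close>
lemma AE_poisson_tendsto_density:
  assumes Z: "Z \<in> null_sets circle_uniform" and f [measurable]: "f \<in> borel_measurable borel"
    and dec: "density M (indicator (- Z)) = density circle_uniform f"
  shows "AE x in circle_uniform. ((\<lambda>r. poisson M (of_real r * x)) \<longlongrightarrow> f x) (at_left 1)"
proof -
  have Zb [measurable]: "Z \<in> sets borel" using Z by (auto simp: null_sets_def)
  interpret S: circle_measure "density M (indicator Z)" by (rule circle_measure_restrict) simp
  interpret A: circle_measure "density M (indicator (- Z))" by (rule circle_measure_restrict) simp
  have "(\<integral>\<^sup>+w. f w \<partial>circle_uniform) = emeasure (density M (indicator (- Z))) UNIV"
    unfolding dec by (simp add: emeasure_density)
  then have fin: "(\<integral>\<^sup>+w. f w \<partial>circle_uniform) < \<infinity>" by (simp add: A.emeasure_finite flip: less_top)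
  have "emeasure (density M (indicator Z)) (- Z) = 0"
    by (simp add: emeasure_restricted)
  then have "AE x in circle_uniform. x \<in> - Z \<longrightarrow>
      ((\<lambda>r. poisson (density M (indicator Z)) (of_real r * x)) \<longlongrightarrow> 0) (at_left 1)"
    by (intro S.AE_poisson_tendsto_0) auto
  moreover have "AE x in circle_uniform. x \<notin> Z" using Z by (rule AE_not_in)
  ultimately show ?thesis using AE_poisson_density_tendsto[OF f fin]
  proof eventually_elim
    case (elim x)
    then have "((\<lambda>r. poisson (density M (indicator Z)) (of_real r * x) +
        poisson (density circle_uniform f) (of_real r * x)) \<longlongrightarrow> 0 + f x) (at_left 1)"
      by (intro tendsto_add) auto
    then show ?case by (simp add: poisson_split[OF Zb] dec)
  qed
qed

text \<open>
  Lebesgue measure has a density \<open>h\<close> with respect to its sum with \<open>M\<close>. The zero set of \<open>h\<close> is null and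
  carries the singular part, and off that set \<open>M\<close> is absolutely continuous.
\<close>
lemma Lebesgue_decomposition:
  obtains Z f where "Z \<in> null_sets circle_uniform" "f \<in> borel_measurable borel"
    "density M (indicator (- Z)) = density circle_uniform f"
proof -
  let ?U = circle_uniform
  define \<kappa> where "\<kappa> = measure_of UNIV (sets borel) (\<lambda>A. emeasure ?U A + emeasure M A)"
  have s\<kappa> [measurable_cong, simp]: "sets \<kappa> = sets borel"
    using sets.sigma_sets_eq[of "borel :: complex measure"] by (simp add: \<kappa>_def)
  have e\<kappa>: "emeasure \<kappa> A = emeasure ?U A + emeasure M A" if "A \<in> sets borel" for A
    unfolding \<kappa>_def
  proof (rule emeasure_measure_of[OF refl])
    show "countably_additive (sets (measure_of UNIV (sets borel) (\<lambda>A. emeasure ?U A + emeasure M A)))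
        (\<lambda>A. emeasure ?U A + emeasure M A)"
      using s\<kappa> unfolding \<kappa>_def[symmetric]
      by (auto simp: countably_additive_def suminf_add[symmetric] suminf_emeasure)
    show "A \<in> sets (measure_of UNIV (sets borel) (\<lambda>A. emeasure ?U A + emeasure M A))"
      using that s\<kappa> by (simp add: \<kappa>_def)
  qed (auto simp: positive_def)
  have sp: "space \<kappa> = UNIV" using sets_eq_imp_space_eq[OF s\<kappa>] by simp
  interpret \<kappa>: finite_measure \<kappa>
    by (rule finite_measureI) (simp add: sp e\<kappa>)
  have "absolutely_continuous \<kappa> ?U"
    unfolding absolutely_continuous_def by (auto simp: null_sets_def e\<kappa>)
  then obtain h where h [measurable]: "h \<in> borel_measurable \<kappa>" and hU: "density \<kappa> h = ?U"
    using \<kappa>.Radon_Nikodym[of ?U] by auto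
  define Z where "Z = {x. h x = 0}"
  have Zb [measurable]: "Z \<in> sets borel"
    using h unfolding Z_def measurable_cong_sets[OF s\<kappa> refl] by measurable
  have "emeasure ?U Z = (\<integral>\<^sup>+x. h x * indicator Z x \<partial>\<kappa>)"
    by (subst hU[symmetric], rule emeasure_density) auto
  also have "\<dots> = (\<integral>\<^sup>+x. 0 \<partial>\<kappa>)" by (intro nn_integral_cong) (auto simp: Z_def indicator_def)
  finally have Z: "Z \<in> null_sets ?U" by (simp add: null_sets_def)
  have "absolutely_continuous ?U (density M (indicator (- Z)))"
    unfolding absolutely_continuous_def
  proof
    fix A assume A: "A \<in> null_sets ?U"
    then have [measurable]: "A \<in> sets borel" by (auto simp: null_sets_def)
    have "(\<integral>\<^sup>+x. h x * indicator A x \<partial>\<kappa>) = emeasure (density \<kappa> h) A"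
      by (rule emeasure_density[symmetric]) auto
    also have "\<dots> = 0" using A by (simp add: hU null_sets_def)
    finally have "AE x in \<kappa>. h x * indicator A x = 0"
      by (subst (asm) nn_integral_0_iff_AE) auto
    then have "AE x in \<kappa>. x \<notin> A \<inter> - Z" by eventually_elim (auto simp: Z_def)
    then have "emeasure \<kappa> (A \<inter> - Z) = 0"
      by (subst (asm) AE_iff_measurable[where N="A \<inter> - Z"]) (auto simp: sp)
    then have "emeasure M (A \<inter> - Z) = 0" by (simp add: e\<kappa>)
    then show "A \<in> null_sets (density M (indicator (- Z)))"
      by (simp add: null_sets_def emeasure_restricted Int_commute)
  qed
  then obtain f where f: "f \<in> borel_measurable ?U" "density ?U f = density M (indicator (- Z))"
    using circle_uniform.Radon_Nikodym[of "density M (indicator (- Z))"] by auto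
  show ?thesis
    by (rule that[OF Z _ f(2)[symmetric]]) (use f(1) in \<open>simp add: measurable_cong_sets[OF circle_uniform.sets_eq refl]\<close>)
qed

end

section \<open>Boundary limits of the Herglotz integral\<close>

lemma radial_seq:
  defines "R \<equiv> \<lambda>n. real (Suc n) / real (Suc (Suc n))"
  shows "0 < R n" "R n < 1" "R \<longlonglongrightarrow> 1"
proof -
  show "0 < R n" "R n < 1" by (simp_all add: R_def)
  have "(\<lambda>n. 1 - 1 / real (Suc (Suc n))) \<longlonglongrightarrow> 1 - 0"
    by (intro tendsto_diff tendsto_const LIMSEQ_Suc lim_1_over_n)
  moreover have "1 - 1 / real (Suc (Suc n)) = R n" for n by (simp add: R_def field_simps)
  ultimately show "R \<longlonglongrightarrow> 1" by simp
qed

text \<open>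
  The Schwarz formula represents each dilation \<open>g (R n * z)\<close> by an absolutely continuous measure, here
  normalized and written in the angular variable. All these probability measures live on \<open>[0, 2 * pi]\<close>, so
  a subsequence converges weakly, and its limit represents \<open>g\<close>.
\<close>
theorem Herglotz_representation:
  assumes hol: "g holomorphic_on ball 0 1" and pos: "\<And>z. norm z < 1 \<Longrightarrow> 0 < Re (g z)"
  obtains N where "circle_measure N" "\<And>z. norm z < 1 \<Longrightarrow> g z = Q N z + \<i> * Im (g 0)"
proof -
  define R where "R n = real (Suc n) / real (Suc (Suc n))" for n
  have R: "0 < R n" "R n < 1" "R \<longlonglongrightarrow> 1" for n
    using radial_seq by (auto simp: R_def[abs_def])
  define c where "c = Re (g 0)"
  have c: "c > 0" using pos[of 0] by (simp add: c_def)
  define G where "G n w = g (of_real (R n) * w)" for n w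
  have in_disc: "norm (of_real (R n) * w) < 1" if "norm w \<le> 1" for n and w :: complex
  proof -
    have "R n * norm w \<le> R n * 1" using that R(1)[of n] by (intro mult_left_mono) auto
    then have "R n * norm w < 1" using R(2)[of n] by linarith
    then show ?thesis using R(1)[of n] by (simp add: norm_mult)
  qed
  have holG: "G n holomorphic_on cball 0 1" for n
    unfolding G_def by (rule holomorphic_on_compose_gen[OF _ hol, unfolded o_def])
      (use in_disc in \<open>auto intro!: holomorphic_intros\<close>)
  have contG: "continuous_on (cball 0 1) (G n)" for n
    by (rule holomorphic_on_imp_continuous_on[OF holG])
  have G0: "G n 0 = g 0" for n by (simp add: G_def)
  have schwarz: "((\<lambda>t. schwarz_kernel (cis t) z * of_real (Re (G n (cis t)))) has_integral
      2 * pi * (G n z - \<i> * Im (g 0))) {0..2*pi}" if "norm z < 1" for n z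
    using has_integral_schwarz_Re[OF contG _ that, of n] holomorphic_on_subset[OF holG ball_subset_cball]
    by (simp add: G0)
  have cont: "continuous_on {0..2*pi} (\<lambda>t. Re (G n (cis t)))" for n
    by (intro continuous_intros continuous_on_compose2[OF contG]) auto
  define D where "D n t = indicator {0..2*pi} t *\<^sub>R (Re (G n (cis t)) / (2 * pi * c))" for n t
  have D_meas [measurable]: "D n \<in> borel_measurable borel" for n
    unfolding D_def[abs_def] by (intro borel_measurable_continuous_on_indicator continuous_intros cont)
      (use c in auto)
  have D_nonneg: "0 \<le> D n t" for n t
    using c pos[of "of_real (R n) * cis t"] in_disc[of "cis t" n] by (simp add: D_def G_def indicator_def)
  define \<mu> where "\<mu> n = density lborel (\<lambda>t. ennreal (D n t))" for n
  have int\<mu>: "(\<integral>t. schwarz_kernel (cis t) z \<partial>\<mu> n) = (G n z - \<i> * Im (g 0)) / c"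
    if z: "norm z < 1" for n z
  proof -
    note ck = continuous_on_schwarz_kernel_cis[OF z, of "{0..2*pi}"]
    have "(\<integral>t. schwarz_kernel (cis t) z \<partial>\<mu> n) = (\<integral>t. D n t *\<^sub>R schwarz_kernel (cis t) z \<partial>lborel)"
      unfolding \<mu>_def by (rule integral_density) (use D_nonneg in auto)
    also have "\<dots> = (\<integral>t. (1 / (2 * pi * c)) *\<^sub>R (indicator {0..2*pi} t *\<^sub>R
        (schwarz_kernel (cis t) z * of_real (Re (G n (cis t))))) \<partial>lborel)"
      by (intro Bochner_Integration.integral_cong) (auto simp: D_def scaleR_conv_of_real)
    also have "\<dots> = (1 / (2 * pi * c)) *\<^sub>R (LINT t:{0..2*pi}|lborel. schwarz_kernel (cis t) z * of_real (Re (G n (cis t))))"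
      unfolding set_lebesgue_integral_def by (rule integral_scaleR_right)
    also have "(LINT t:{0..2*pi}|lborel. schwarz_kernel (cis t) z * of_real (Re (G n (cis t)))) =
        integral {0..2*pi} (\<lambda>t. schwarz_kernel (cis t) z * of_real (Re (G n (cis t))))"
      by (intro set_borel_integral_eq_integral borel_integrable_atLeastAtMost' continuous_intros ck cont)
    also have "\<dots> = 2 * pi * (G n z - \<i> * Im (g 0))" by (rule integral_unique[OF schwarz[OF z]])
    finally have *: "(\<integral>t. schwarz_kernel (cis t) z \<partial>\<mu> n)
        = of_real (1 / (2 * pi * c)) * (of_real (2 * pi) * (G n z - \<i> * Im (g 0)))"
      by (simp only: scaleR_conv_of_real)
    have "1 / (2 * pi * c) * (2 * pi) = 1 / c" by simp
    then show ?thesis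
      unfolding * mult.assoc[symmetric] of_real_mult[symmetric] by simp
  qed
  have total: "emeasure (\<mu> n) UNIV = 1" for n
  proof -
    have "((\<lambda>t. Re (G n (cis t))) has_integral 2 * pi * c) {0..2*pi}"
      using has_integral_linear[OF schwarz[of 0 n] bounded_linear_Re]
      by (simp add: o_def schwarz_kernel_def G0 c_def)
    then have int: "((\<lambda>t. Re (G n (cis t)) / (2 * pi * c)) has_integral (2 * pi * c) / (2 * pi * c)) {0..2*pi}"
      by (rule has_integral_divide)
    have "(D n has_integral 1) UNIV"
    proof -
      have "D n = (\<lambda>t. if t \<in> {0..2*pi} then Re (G n (cis t)) / (2 * pi * c) else 0)"
        by (auto simp: D_def fun_eq_iff)
      then show ?thesis using int c by (simp only: has_integral_restrict_UNIV) simp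
    qed
    then have "(\<integral>\<^sup>+t. D n t \<partial>lborel) = ennreal 1"
      by (rule nn_integral_has_integral_lborel[OF D_meas D_nonneg])
    then show ?thesis by (simp add: \<mu>_def emeasure_density)
  qed
  have dist\<mu>: "real_distribution (\<mu> n)" for n
  proof -
    have "space (\<mu> n) = UNIV" by (simp add: \<mu>_def)
    then have "prob_space (\<mu> n)" using total[of n] by (intro prob_spaceI) simp
    then show ?thesis
      by (intro real_distribution.intro real_distribution_axioms.intro) (simp_all add: \<mu>_def)
  qed
  interpret \<mu>: real_distribution "\<mu> n" for n by (rule dist\<mu>)
  have "tight \<mu>"
    unfolding tight_def
  proof (intro conjI allI impI dist\<mu>)
    fix \<epsilon> :: real assume \<epsilon>: "\<epsilon> > 0"
    have "measure (\<mu> n) {-1<..2*pi} = 1" for n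
    proof (rule \<mu>.prob_eq_1[THEN iffD2])
      show "AE t in \<mu> n. t \<in> {-1<..2*pi}"
      proof -
        have m: "(\<lambda>t. ennreal (D n t)) \<in> borel_measurable lborel" by measurable
        show ?thesis unfolding \<mu>_def AE_density[OF m] by (auto simp: D_def indicator_def)
      qed
    qed simp
    moreover have "(-1 :: real) < 2 * pi" using pi_gt_zero by linarith
    ultimately show "\<exists>a b. a < b \<and> (\<forall>n. 1 - \<epsilon> < measure (\<mu> n) {a<..b})"
      using \<epsilon> by (intro exI[of _ "-1"] exI[of _ "2*pi"] conjI) simp_all
  qed
  then obtain r M where r: "strict_mono r" "real_distribution M" "weak_conv_m (\<mu> \<circ> id \<circ> r) M"
    using tight_imp_convergent_subsubsequence[of \<mu> id] by (auto simp: strict_mono_def)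
  interpret M: real_distribution M by (rule r(2))
  have lim: "(\<integral>t. schwarz_kernel (cis t) z \<partial>M) = (g z - \<i> * Im (g 0)) / c" if z: "norm z < 1" for z
  proof (rule LIMSEQ_unique)
    show "(\<lambda>n. \<integral>t. schwarz_kernel (cis t) z \<partial>(\<mu> \<circ> id \<circ> r) n) \<longlonglongrightarrow> (\<integral>t. schwarz_kernel (cis t) z \<partial>M)"
    proof (rule weak_conv_imp_integral_bdd_continuous_conv[OF _ r(2,3)])
      show "real_distribution ((\<mu> \<circ> id \<circ> r) n)" for n by (simp add: dist\<mu>)
      show "norm (schwarz_kernel (cis t) z) \<le> 2 / (1 - norm z)" for t
        using z by (intro norm_schwarz_kernel_le) auto
      show "isCont (\<lambda>t. schwarz_kernel (cis t) z) t" for t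
        using continuous_on_schwarz_kernel_cis[OF z, of UNIV] by (simp add: continuous_on_eq_continuous_at)
    qed
    have "isCont g (1 * z)"
      using z holomorphic_on_imp_continuous_on[OF hol] by (simp add: continuous_on_eq_continuous_at)
    moreover have "(\<lambda>n. of_real (R (r n)) * z) \<longlonglongrightarrow> of_real 1 * z"
      by (intro tendsto_intros LIMSEQ_subseq_LIMSEQ[OF R(3) r(1), unfolded o_def])
    ultimately have "(\<lambda>n. G (r n) z) \<longlonglongrightarrow> g z"
      unfolding G_def using isCont_tendsto_compose[of "1 * z" g] by simp
    then have "(\<lambda>n. (G (r n) z - \<i> * Im (g 0)) / c) \<longlonglongrightarrow> (g z - \<i> * Im (g 0)) / c"
      using c by (intro tendsto_intros) auto
    then show "(\<lambda>n. \<integral>t. schwarz_kernel (cis t) z \<partial>(\<mu> \<circ> id \<circ> r) n) \<longlonglongrightarrow> (g z - \<i> * Im (g 0)) / c"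
      using z by (simp add: int\<mu>)
  qed
  define N where "N = density (distr M borel cis) (\<lambda>_. ennreal c)"
  interpret DM: prob_space "distr M borel cis" by (rule M.prob_space_distr) simp
  have "emeasure (distr M borel cis) UNIV = 1" using DM.emeasure_space_1 by simp
  then interpret N: finite_measure N
    by (intro finite_measureI) (simp add: N_def emeasure_density nn_integral_cmult ennreal_mult_eq_top_iff)
  have circ: "{w::complex. norm w = 1} \<in> sets borel"
    by (intro borel_closed closed_Collect_eq continuous_intros)
  have "circle_measure N"
  proof (intro circle_measure.intro circle_measure_axioms.intro)
    have "AE w in distr M borel cis. norm w = 1"
      using circ by (subst AE_distr_iff) auto
    then show "AE w in N. norm w = 1" unfolding N_def by (subst AE_density) auto
  qed (simp_all add: N_def N.finite_measure_axioms[unfolded N_def])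
  moreover have "g z = Q N z + \<i> * Im (g 0)" if z: "norm z < 1" for z
  proof -
    interpret N: circle_measure N by fact
    have "Q N z = (\<integral>w. c *\<^sub>R schwarz_kernel w z \<partial>distr M borel cis)"
      unfolding N.Q_altdef unfolding N_def by (rule integral_density) (use c in auto)
    also have "\<dots> = c *\<^sub>R (\<integral>w. schwarz_kernel w z \<partial>distr M borel cis)"
      by (rule integral_scaleR_right)
    also have "(\<integral>w. schwarz_kernel w z \<partial>distr M borel cis) = (\<integral>t. schwarz_kernel (cis t) z \<partial>M)"
      by (rule integral_distr) auto
    finally show ?thesis using c by (simp add: lim[OF z] scaleR_conv_of_real)
  qed
  ultimately show ?thesis by (rule that)
qed

context circle_measure begin

lemma AE_Re_Q_tendsto:
  assumes Z: "Z \<in> null_sets circle_uniform" and f [measurable]: "f \<in> borel_measurable borel"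
    and dec: "density M (indicator (- Z)) = density circle_uniform f"
  shows "AE x in circle_uniform. f x \<noteq> \<top> \<and> ((\<lambda>r. Re (Q M (of_real r * x))) \<longlongrightarrow> enn2real (f x)) (at_left 1)"
proof -
  have Zb [measurable]: "Z \<in> sets borel" using Z by (auto simp: null_sets_def)
  interpret A: circle_measure "density M (indicator (- Z))" by (rule circle_measure_restrict) simp
  have "(\<integral>\<^sup>+w. f w \<partial>circle_uniform) = emeasure (density M (indicator (- Z))) UNIV"
    unfolding dec by (simp add: emeasure_density)
  then have "AE x in circle_uniform. f x \<noteq> \<infinity>"
    by (intro nn_integral_noteq_infinite) (use A.emeasure_finite in auto)
  then show ?thesis using AE_poisson_tendsto_density[OF assms] circle_uniform.AE_circle
  proof eventually_elim
    case (elim x)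
    have "((\<lambda>r. enn2real (poisson M (of_real r * x))) \<longlongrightarrow> enn2real (f x)) (at_left 1)"
      using elim by (intro tendsto_enn2real) (auto simp: less_top)
    moreover have "\<forall>\<^sub>F r in at_left 1. enn2real (poisson M (of_real r * x)) = Re (Q M (of_real r * x))"
      using eventually_at_left_real[of 0 1, OF zero_less_one]
    proof eventually_elim
      case el: (elim r)
      then have "norm (of_real r * x) < 1" using elim by (simp add: norm_mult)
      then show ?case by (simp add: poisson_eq Re_Q_nonneg)
    qed
    ultimately show ?case using elim(1) by (auto intro: Lim_transform_eventually)
  qed
qed

lemma AE_Re_Q_convergent:
  "AE x in circle_uniform. \<exists>l. ((\<lambda>r. Re (Q M (of_real r * x))) \<longlongrightarrow> l) (at_left 1)"
proof -
  obtain Z f where "Z \<in> null_sets circle_uniform" "f \<in> borel_measurable borel"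
    "density M (indicator (- Z)) = density circle_uniform f" by (rule Lebesgue_decomposition)
  from AE_Re_Q_tendsto[OF this] show ?thesis by eventually_elim auto
qed

text \<open>
  Radial limits of real parts exist almost everywhere for every Herglotz integral; the point is to
  reach the imaginary part. The square root \<open>s\<close> of \<open>1 + Q M\<close> takes values in the sector
  \<open>\<bar>Im\<bar> < Re\<close>, so both \<open>(1 + \<i>) * s\<close> and \<open>(1 - \<i>) * s\<close> have positive real part and are Herglotz
  integrals themselves. Their real parts \<open>Re s - Im s\<close> and \<open>Re s + Im s\<close> converge almost everywhere, to
  finite limits, and hence so do \<open>s\<close> and its square.
\<close>
theorem AE_Q_convergent:
  "AE x in circle_uniform. \<exists>l. ((\<lambda>r. Q M (of_real r * x)) \<longlongrightarrow> l) (at_left 1)"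
proof -
  define s where "s z = csqrt (1 + Q M z)" for z
  have F: "1 \<le> Re (1 + Q M z)" if "norm z < 1" for z using Re_Q_nonneg[OF that] by simp
  have s2: "(s z)\<^sup>2 = 1 + Q M z" for z by (simp add: s_def)
  have hol: "s holomorphic_on ball 0 1"
    unfolding s_def using F
    by (intro holomorphic_intros Q_holomorphic) (force simp: complex_nonpos_Reals_iff)
  have sector: "\<bar>Im (s z)\<bar> < Re (s z)" if "norm z < 1" for z
  proof -
    have "(Re (s z))\<^sup>2 - (Im (s z))\<^sup>2 = Re ((s z)\<^sup>2)" by (simp add: power2_eq_square)
    also have "\<dots> \<ge> 1" using F[OF that] by (simp add: s2)
    finally have "\<bar>Im (s z)\<bar>\<^sup>2 < (Re (s z))\<^sup>2" by simp
    moreover have "0 \<le> Re (s z)" by (simp only: s_def Re_csqrt)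
    ultimately show ?thesis by (rule power2_less_imp_less)
  qed
  obtain N1 where N1: "circle_measure N1" "\<And>z. norm z < 1 \<Longrightarrow> (1 + \<i>) * s z = Q N1 z + \<i> * Im ((1 + \<i>) * s 0)"
  proof (rule Herglotz_representation[of "\<lambda>z. (1 + \<i>) * s z"])
    show "(\<lambda>z. (1 + \<i>) * s z) holomorphic_on ball 0 1" by (intro holomorphic_intros hol)
    show "0 < Re ((1 + \<i>) * s z)" if "norm z < 1" for z using sector[OF that] by (simp add: abs_less_iff)
  qed (rule that)
  obtain N2 where N2: "circle_measure N2" "\<And>z. norm z < 1 \<Longrightarrow> (1 - \<i>) * s z = Q N2 z + \<i> * Im ((1 - \<i>) * s 0)"
  proof (rule Herglotz_representation[of "\<lambda>z. (1 - \<i>) * s z"])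
    show "(\<lambda>z. (1 - \<i>) * s z) holomorphic_on ball 0 1" by (intro holomorphic_intros hol)
    show "0 < Re ((1 - \<i>) * s z)" if "norm z < 1" for z using sector[OF that] by (simp add: abs_less_iff)
  qed (rule that)
  have Q1: "Re (Q N1 z) = Re (s z) - Im (s z)" if "norm z < 1" for z
    using arg_cong[OF N1(2)[OF that], of Re] by simp
  have Q2: "Re (Q N2 z) = Re (s z) + Im (s z)" if "norm z < 1" for z
    using arg_cong[OF N2(2)[OF that], of Re] by simp
  show ?thesis
    using circle_measure.AE_Re_Q_convergent[OF N1(1)] circle_measure.AE_Re_Q_convergent[OF N2(1)]
      circle_uniform.AE_circle
  proof eventually_elim
    case (elim x)
    then obtain l1 l2 where l:
      "((\<lambda>r. Re (Q N1 (of_real r * x))) \<longlongrightarrow> l1) (at_left 1)"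
      "((\<lambda>r. Re (Q N2 (of_real r * x))) \<longlongrightarrow> l2) (at_left 1)" by auto
    have "((\<lambda>r. (Complex ((Re (Q N1 (of_real r * x)) + Re (Q N2 (of_real r * x))) / 2)
        ((Re (Q N2 (of_real r * x)) - Re (Q N1 (of_real r * x))) / 2))\<^sup>2 - 1)
        \<longlongrightarrow> (Complex ((l1 + l2) / 2) ((l2 - l1) / 2))\<^sup>2 - 1) (at_left 1)"
      by (intro tendsto_intros l) auto
    moreover have "\<forall>\<^sub>F r in at_left 1. (Complex ((Re (Q N1 (of_real r * x)) + Re (Q N2 (of_real r * x))) / 2)
        ((Re (Q N2 (of_real r * x)) - Re (Q N1 (of_real r * x))) / 2))\<^sup>2 - 1 = Q M (of_real r * x)"
      using eventually_at_left_real[of 0 1, OF zero_less_one]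
    proof eventually_elim
      case el: (elim r)
      then have n: "norm (of_real r * x) < 1" using elim by (simp add: norm_mult)
      then show ?case by (simp add: Q1[OF n] Q2[OF n] s2)
    qed
    ultimately show ?case by (auto intro: Lim_transform_eventually)
  qed
qed

end

section \<open>Atoms of the reciprocal measure\<close>

context circle_measure begin

text \<open>
  Multiplied by \<open>(1 - r) / 2\<close>, the kernel is bounded by 1 and converges to the indicator of \<open>x\<close>.
\<close>
lemma point_mass_limit:
  assumes x: "norm x = 1" and R: "\<And>n. 0 < R n" "\<And>n. R n < 1" "R \<longlonglongrightarrow> (1::real)"
  shows "(\<lambda>n. of_real ((1 - R n) / 2) * Q M (of_real (R n) * x)) \<longlonglongrightarrow> of_real (measure M {x})"
proof -
  have nR: "norm (of_real (R n) * x) = R n" for n using x R(1)[of n] by (simp add: norm_mult)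
  have "(\<lambda>n. \<integral>w. of_real ((1 - R n) / 2) * schwarz_kernel w (of_real (R n) * x) \<partial>M) \<longlonglongrightarrow>
      (\<integral>w. indicator {x} w \<partial>M :: complex)"
  proof (rule integral_dominated_convergence[where w="\<lambda>_. 1"])
    show "AE w in M. (\<lambda>n. of_real ((1 - R n) / 2) * schwarz_kernel w (of_real (R n) * x)) \<longlonglongrightarrow> indicator {x} w"
      using AE_circle
    proof eventually_elim
      case (elim w)
      show ?case
      proof (cases "w = x")
        case True
        have "cnj x * x = 1" using x by (simp add: complex_norm_square[symmetric] mult.commute)
        then have xx: "cnj x * (of_real (R n) * x) = of_real (R n)" for n
          by (simp add: mult.left_commute)
        have gen: "(1 - a) / 2 * ((1 + a) / (1 - a)) = (1 + a) / 2" if "a \<noteq> 1" for a :: complex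
          by (subst times_divide_times_eq, subst mult.commute[of 2], rule nonzero_mult_divide_mult_cancel_left)
            (use that in simp)
        have "complex_of_real (R n) \<noteq> 1" for n using R(2)[of n] by simp
        then have "of_real ((1 - R n) / 2) * schwarz_kernel w (of_real (R n) * x) = of_real ((1 + R n) / 2)" for n
          using gen[of "of_real (R n)"] unfolding True schwarz_kernel_def xx by simp
        moreover have "(\<lambda>n. of_real ((1 + R n) / 2)) \<longlonglongrightarrow> (of_real ((1 + 1) / 2) :: complex)"
          by (intro tendsto_intros R(3)) auto
        ultimately show ?thesis using True by simp
      next
        case False
        then have "1 - cnj w * (of_real 1 * x) \<noteq> 0"
          using norm_one_minus_cnj_mult[OF elim, of x] by auto
        then have "(\<lambda>n. of_real ((1 - R n) / 2) * schwarz_kernel w (of_real (R n) * x))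
            \<longlonglongrightarrow> of_real ((1 - 1) / 2) * schwarz_kernel w (of_real 1 * x)"
          unfolding schwarz_kernel_def by (intro tendsto_intros R(3)) auto
        then show ?thesis using False by simp
      qed
    qed
    show "AE w in M. norm (of_real ((1 - R n) / 2) * schwarz_kernel w (of_real (R n) * x)) \<le> 1" for n
      using AE_circle
    proof eventually_elim
      case (elim w)
      have "norm (of_real ((1 - R n) / 2) * schwarz_kernel w (of_real (R n) * x))
          = (1 - R n) / 2 * norm (schwarz_kernel w (of_real (R n) * x))"
        unfolding norm_mult norm_of_real using R(2)[of n] by simp
      also have "\<dots> \<le> (1 - R n) / 2 * (2 / (1 - R n))"
        using norm_schwarz_kernel_le[OF elim, of "of_real (R n) * x"] R(2)[of n]
        unfolding nR by (intro mult_left_mono) auto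
      also have "\<dots> = 1" using R(2)[of n] by simp
      finally show ?case .
    qed
  qed auto
  moreover have "(\<integral>w. of_real ((1 - R n) / 2) * schwarz_kernel w (of_real (R n) * x) \<partial>M)
      = of_real ((1 - R n) / 2) * Q M (of_real (R n) * x)" for n
    unfolding Q_altdef using R(2)[of n] nR[of n]
    by (intro Bochner_Integration.integral_mult_right) (auto intro!: integrable_schwarz_kernel)
  moreover have "(\<integral>w. indicator {x} w \<partial>M :: complex) = of_real (measure M {x})"
  proof -
    have "(\<integral>w. indicator {x} w \<partial>M :: complex) = (\<integral>w. of_real (indicator {x} w) \<partial>M)"
      by (intro Bochner_Integration.integral_cong) (auto simp: indicator_def)
    then show ?thesis by simp
  qed
  ultimately show ?thesis by (simp only:)
qed

text \<open>
  Up to the factor 4 this is the integral of \<open>1 / sin\<^sup>2\<close> of the half angle; the chord between two points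
  of the circle has length \<open>2 * \<bar>sin\<bar>\<close> of that half angle.
\<close>
definition energy :: "complex \<Rightarrow> ennreal" where
  "energy x = (\<integral>\<^sup>+w. inverse (ennreal ((norm (w - x))\<^sup>2)) \<partial>M)"

text \<open>
  Fatou's lemma: \<open>Re Q / (1 - r)\<close> is the integral of \<open>(1 + r) / \<bar>w - r * x\<bar>\<^sup>2\<close>, which dominates
  \<open>1 / (\<bar>w - x\<bar> + 1 - r)\<^sup>2\<close>.
\<close>
lemma energy_le:
  assumes x: "norm x = 1" and R: "\<And>n. 0 < R n" "\<And>n. R n < 1" "R \<longlonglongrightarrow> (1::real)"
    and C: "\<And>n. Re (Q M (of_real (R n) * x)) \<le> C * (1 - R n)"
  shows "energy x \<le> ennreal C"
proof -
  have nR: "norm (of_real (R n) * x) = R n" for n using x R(1)[of n] by (simp add: norm_mult)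
  define f where "f n w = inverse (ennreal ((norm (w - x) + (1 - R n))\<^sup>2))" for n w
  have f_meas [measurable]: "f n \<in> borel_measurable borel" for n unfolding f_def by measurable
  have f_lim: "(\<lambda>n. f n w) \<longlonglongrightarrow> inverse (ennreal ((norm (w - x))\<^sup>2))" for w
  proof -
    have "(\<lambda>n. (norm (w - x) + (1 - R n))\<^sup>2) \<longlonglongrightarrow> (norm (w - x) + (1 - 1))\<^sup>2"
      by (intro tendsto_intros R(3))
    then have "(\<lambda>n. ennreal ((norm (w - x) + (1 - R n))\<^sup>2)) \<longlonglongrightarrow> ennreal ((norm (w - x))\<^sup>2)"
      by (intro tendsto_ennrealI) simp
    moreover have "isCont inverse (ennreal ((norm (w - x))\<^sup>2))"
      using continuous_on_inverse_ennreal[of UNIV "\<lambda>y. y"]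
      by (simp add: continuous_on_eq_continuous_at)
    ultimately show ?thesis unfolding f_def by (rule isCont_tendsto_compose[rotated])
  qed
  have f_le: "(\<integral>\<^sup>+w. f n w \<partial>M) \<le> ennreal C" for n
  proof -
    have r: "1 - R n > 0" "R n > 0" using R by auto
    have "(\<integral>\<^sup>+w. f n w \<partial>M) \<le> (\<integral>\<^sup>+w. ennreal (1 / (1 - R n)) * ennreal (poisson_kernel w (of_real (R n) * x)) \<partial>M)"
    proof (rule nn_integral_mono_AE)
      show "AE w in M. f n w \<le> ennreal (1 / (1 - R n)) * ennreal (poisson_kernel w (of_real (R n) * x))"
        using AE_circle
      proof eventually_elim
        case (elim w)
        define d where "d = norm (w - of_real (R n) * x)"
        have "norm (x - of_real (R n) * x) = 1 - R n" using x r by (intro norm_radial_diff) auto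
        then have d: "d \<le> norm (w - x) + (1 - R n)"
          using norm_triangle_ineq[of "w - x" "x - of_real (R n) * x"] by (simp add: d_def)
        have d0: "d > 0"
          using norm_diff_ge[OF elim, of "of_real (R n) * x", folded d_def] nR[of n] r by linarith
        have "f n w = ennreal (1 / (norm (w - x) + (1 - R n))\<^sup>2)"
        proof -
          have "0 < norm (w - x) + (1 - R n)" using r norm_ge_zero[of "w - x"] by linarith
          then show ?thesis unfolding f_def by (subst inverse_ennreal) (simp_all add: divide_inverse)
        qed
        also have "\<dots> \<le> ennreal ((1 + R n) / d\<^sup>2)"
          using d d0 r by (intro ennreal_leI frac_le power_mono) auto
        also have "(1 + R n) / d\<^sup>2 = 1 / (1 - R n) * poisson_kernel w (of_real (R n) * x)"
          using r d0 unfolding poisson_kernel_def nR d_def[symmetric]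
          by (simp add: field_simps power2_eq_square)
        finally show ?case using r by (subst (asm) ennreal_mult') simp_all
      qed
    qed
    also have "\<dots> = ennreal (1 / (1 - R n)) * ennreal (Re (Q M (of_real (R n) * x)))"
      using poisson_eq[of "of_real (R n) * x"] nR[of n] R(2)[of n]
      by (simp add: nn_integral_cmult poisson_def)
    also have "\<dots> = ennreal (Re (Q M (of_real (R n) * x)) / (1 - R n))"
      using r by (simp add: ennreal_mult'[symmetric])
    also have "\<dots> \<le> ennreal C"
      using C[of n] r by (intro ennreal_leI) (simp add: field_simps)
    finally show ?thesis .
  qed
  have "energy x = (\<integral>\<^sup>+w. liminf (\<lambda>n. f n w) \<partial>M)"
    unfolding energy_def by (intro nn_integral_cong lim_imp_Liminf[symmetric] f_lim) simp
  also have "\<dots> \<le> liminf (\<lambda>n. \<integral>\<^sup>+w. f n w \<partial>M)" by (rule nn_integral_liminf) measurable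
  also have "\<dots> \<le> ennreal C" by (intro Liminf_le always_eventually allI f_le) simp
  finally show ?thesis .
qed

text \<open>
  Finite energy makes the kernel integrable at the boundary point \<open>x\<close> itself, where it is purely
  imaginary. The difference quotient of the kernel along the radius is
  \<open>- 2 * w * x / ((w - r * x) * (w - x))\<close>, which is dominated by \<open>4 / \<bar>w - x\<bar>\<^sup>2\<close> and tends to
  \<open>- 2 * w * x / (w - x)\<^sup>2\<close>, that is, to \<open>2 / \<bar>w - x\<bar>\<^sup>2\<close> on the circle.
\<close>
lemma Q_angular_derivative:
  assumes x: "norm x = 1" and R: "\<And>n. 0 < R n" "\<And>n. R n < 1" "R \<longlonglongrightarrow> (1::real)"
    and e: "energy x < \<top>"
  obtains h where "(\<lambda>n. Q M (of_real (R n) * x)) \<longlonglongrightarrow> \<i> * of_real h"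
    "(\<lambda>n. (Q M (of_real (R n) * x) - \<i> * of_real h) / of_real (1 - R n)) \<longlonglongrightarrow> of_real (2 * enn2real (energy x))"
proof -
  have nR: "norm (of_real (R n) * x) = R n" for n using x R(1)[of n] by (simp add: norm_mult)
  define D where "D w = 1 / (norm (w - x))\<^sup>2" for w
  have D_meas [measurable]: "D \<in> borel_measurable borel" unfolding D_def by measurable
  have ne: "AE w in M. w \<noteq> x"
  proof -
    have "AE w in M. inverse (ennreal ((norm (w - x))\<^sup>2)) \<noteq> \<infinity>"
      by (rule nn_integral_noteq_infinite) (use e in \<open>auto simp: energy_def\<close>)
    then show ?thesis by eventually_elim auto
  qed
  have eD: "energy x = (\<integral>\<^sup>+w. ennreal (D w) \<partial>M)"
    unfolding energy_def
  proof (rule nn_integral_cong_AE)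
    show "AE w in M. inverse (ennreal ((norm (w - x))\<^sup>2)) = ennreal (D w)"
      using ne by eventually_elim (subst inverse_ennreal, auto simp: D_def divide_inverse)
  qed
  have D_nonneg: "0 \<le> D w" for w by (simp add: D_def)
  have intD: "integrable M D"
    by (rule integrableI_nonneg) (use D_nonneg e eD in auto)
  have ID: "(\<integral>w. D w \<partial>M) = enn2real (energy x)"
    unfolding eD by (rule integral_eq_nn_integral) (use D_nonneg in auto)
  have bd: "norm (schwarz_kernel w x) \<le> 4 * D w" if w: "norm w = 1" "w \<noteq> x" for w
  proof -
    define d where "d = norm (w - x)"
    have d: "0 < d" "d \<le> 2" using w x norm_triangle_ineq4[of w x] by (auto simp: d_def)
    have "norm (1 + cnj w * x) \<le> 2" using norm_triangle_ineq[of 1 "cnj w * x"] w x by (simp add: norm_mult)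
    then have "norm (schwarz_kernel w x) \<le> 2 / d"
      unfolding schwarz_kernel_def norm_divide norm_one_minus_cnj_mult[OF w(1)] d_def by (intro divide_right_mono) auto
    also have "\<dots> \<le> 4 * D w" using d unfolding D_def d_def[symmetric] by (simp add: field_simps power2_eq_square)
    finally show ?thesis .
  qed
  have intK: "integrable M (\<lambda>w. schwarz_kernel w x)"
    by (rule Bochner_Integration.integrable_bound[where f="\<lambda>w. 4 * D w"])
       (use intD ne AE_circle bd D_nonneg in auto)
  define L where "L = (\<integral>w. schwarz_kernel w x \<partial>M)"
  have "Re L = (\<integral>w. Re (schwarz_kernel w x) \<partial>M)" unfolding L_def by (rule integral_Re[OF intK, symmetric])
  also have "\<dots> = (\<integral>w. 0 \<partial>M)"
    by (rule integral_cong_AE) (use AE_circle Re_schwarz_kernel x in \<open>auto simp: poisson_kernel_def\<close>)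
  finally have L: "L = \<i> * of_real (Im L)" by (simp add: complex_eq_iff)
  have "(\<lambda>n. \<integral>w. (schwarz_kernel w (of_real (R n) * x) - schwarz_kernel w x) / of_real (1 - R n) \<partial>M) \<longlonglongrightarrow>
      (\<integral>w. of_real (2 * D w) \<partial>M)"
  proof (rule integral_dominated_convergence[where w="\<lambda>w. 4 * D w"])
    have eq: "(schwarz_kernel w (of_real (R n) * x) - schwarz_kernel w x) / of_real (1 - R n)
        = - 2 * w * x / ((w - of_real (R n) * x) * (w - x))" if w: "norm w = 1" "w \<noteq> x" for w n
    proof -
      have ww: "cnj w * w = 1" using w by (simp add: complex_norm_square[symmetric] mult.commute)
      have K: "schwarz_kernel w z = (w + z) / (w - z)" for z
      proof -
        have "1 - cnj w * z = cnj w * (w - z)" "1 + cnj w * z = cnj w * (w + z)"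
          using ww by (simp_all add: algebra_simps)
        moreover have "cnj w \<noteq> 0" using w by auto
        ultimately show ?thesis by (simp add: schwarz_kernel_def)
      qed
      have a: "w - of_real (R n) * x \<noteq> 0"
        using norm_diff_ge[OF w(1), of "of_real (R n) * x"] nR[of n] R(2)[of n] by auto
      have b: "w - x \<noteq> 0" using w by simp
      have c: "1 - complex_of_real (R n) \<noteq> 0" using R(2)[of n] by (simp flip: of_real_diff)
      have "schwarz_kernel w (of_real (R n) * x) - schwarz_kernel w x
        = ((w + of_real (R n) * x) * (w - x) - (w + x) * (w - of_real (R n) * x)) / ((w - of_real (R n) * x) * (w - x))"
        unfolding K using a b by (simp add: diff_frac_eq)
      also have "(w + of_real (R n) * x) * (w - x) - (w + x) * (w - of_real (R n) * x) = - 2 * w * x * (1 - of_real (R n))"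
        by (simp add: algebra_simps)
      finally show ?thesis using c by simp
    qed
    show "AE w in M. (\<lambda>n. (schwarz_kernel w (of_real (R n) * x) - schwarz_kernel w x) / of_real (1 - R n)) \<longlonglongrightarrow> of_real (2 * D w)"
      using ne AE_circle
    proof eventually_elim
      case (elim w)
      have "(\<lambda>n. - 2 * w * x / ((w - of_real (R n) * x) * (w - x))) \<longlonglongrightarrow> - 2 * w * x / ((w - of_real 1 * x) * (w - x))"
        using elim by (intro tendsto_intros R(3)) auto
      also have "- 2 * w * x / ((w - of_real 1 * x) * (w - x)) = of_real (2 * D w)"
      proof -
        have ww: "cnj w * w = 1" "cnj x * x = 1"
          using elim x by (simp_all add: complex_norm_square[symmetric] mult.commute)
        have "of_real ((norm (w - x))\<^sup>2) * (w * x) = (w - x) * ((cnj w - cnj x) * (w * x))"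
          by (simp only: complex_norm_square complex_cnj_diff mult.assoc)
        also have "(cnj w - cnj x) * (w * x) = (cnj w * w) * x - (cnj x * x) * w"
          by (simp add: algebra_simps)
        also have "\<dots> = - (w - x)" using ww by simp
        finally have *: "of_real ((norm (w - x))\<^sup>2) * (w * x) = - ((w - x) * (w - x))"
          by (simp add: algebra_simps)
        have "- 2 * w * x * of_real ((norm (w - x))\<^sup>2) = - 2 * (of_real ((norm (w - x))\<^sup>2) * (w * x))"
          by (simp only: mult_ac)
        also have "\<dots> = 2 * ((w - x) * (w - x))" unfolding * by simp
        finally have eq2: "- 2 * w * x * of_real ((norm (w - x))\<^sup>2) = 2 * ((w - x) * (w - x))" .
        have nz: "(w - x) * (w - x) \<noteq> 0" "of_real ((norm (w - x))\<^sup>2) \<noteq> (0::complex)" using elim by auto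
        have "- 2 * w * x / ((w - x) * (w - x)) = 2 / of_real ((norm (w - x))\<^sup>2)"
          by (rule frac_eq_eq[THEN iffD2, OF nz eq2])
        then show ?thesis by (simp add: D_def)
      qed
      finally show ?case using eq[OF elim(2,1)] by simp
    qed
    show "AE w in M. norm ((schwarz_kernel w (of_real (R n) * x) - schwarz_kernel w x) / of_real (1 - R n)) \<le> 4 * D w" for n
      using ne AE_circle
    proof eventually_elim
      case (elim w)
      define d where "d = norm (w - of_real (R n) * x)"
      have r: "1 - R n > 0" using R(2)[of n] by simp
      have "norm (x - of_real (R n) * x) = 1 - R n" using x r by (intro norm_radial_diff) auto
      then have "norm (w - x) \<le> d + (1 - R n)"
        using norm_triangle_ineq4[of "w - of_real (R n) * x" "x - of_real (R n) * x"] by (simp add: d_def)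
      moreover have "1 - R n \<le> d" using norm_diff_ge[OF elim(2), of "of_real (R n) * x"] nR[of n] by (simp add: d_def)
      ultimately have d: "norm (w - x) / 2 \<le> d" by simp
      have nw: "0 < norm (w - x)" using elim by simp
      have "norm ((schwarz_kernel w (of_real (R n) * x) - schwarz_kernel w x) / of_real (1 - R n))
          = 2 / (d * norm (w - x))"
        unfolding eq[OF elim(2,1)] using elim x by (simp add: norm_mult norm_divide d_def)
      also have "\<dots> \<le> 2 / (norm (w - x) / 2 * norm (w - x))"
        by (intro frac_le mult_right_mono mult_pos_pos) (use d nw in simp_all)
      also have "\<dots> = 4 * D w" by (simp add: D_def power2_eq_square)
      finally show ?case .
    qed
  qed (use intD in auto)
  moreover have "(\<integral>w. (schwarz_kernel w (of_real (R n) * x) - schwarz_kernel w x) / of_real (1 - R n) \<partial>M)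
      = (Q M (of_real (R n) * x) - L) / of_real (1 - R n)" for n
    unfolding Q_altdef L_def using integrable_schwarz_kernel[of "of_real (R n) * x"] nR[of n] R(2)[of n] intK
    by (simp del: of_real_diff)
  moreover have "(\<integral>w. of_real (2 * D w) \<partial>M) = complex_of_real (2 * enn2real (energy x))"
    unfolding ID[symmetric] by (simp only: integral_complex_of_real Bochner_Integration.integral_mult_right_zero)
  ultimately have der: "(\<lambda>n. (Q M (of_real (R n) * x) - L) / of_real (1 - R n)) \<longlonglongrightarrow> complex_of_real (2 * enn2real (energy x))"
    by (simp only:)
  have "(\<lambda>n. (Q M (of_real (R n) * x) - L) / of_real (1 - R n) * of_real (1 - R n) + L)
      \<longlonglongrightarrow> complex_of_real (2 * enn2real (energy x)) * of_real (1 - 1) + L"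
    by (intro tendsto_intros der R(3))
  moreover have "(Q M (of_real (R n) * x) - L) / of_real (1 - R n) * of_real (1 - R n) + L = Q M (of_real (R n) * x)" for n
    using R(2)[of n] by (simp del: of_real_diff)
  ultimately have "(\<lambda>n. Q M (of_real (R n) * x)) \<longlonglongrightarrow> L" by simp
  then show ?thesis using der L by (intro that[of "Im L"]) simp_all
qed

text \<open>
  The atom of \<open>M\<close> at \<open>x\<close> is the limit of \<open>(1 - r) / 2\<close> divided by \<open>F = Q N + \<i> * a\<close>. If it is positive then
  \<open>F / (1 - r)\<close> stays bounded, and the energy is finite. If the energy is finite then \<open>F\<close> tends to 0 along
  the radius, because its imaginary part does by assumption and its boundary value is imaginary; so
  \<open>F / (1 - r)\<close> tends to twice the energy.
\<close>
theorem measure_singleton_reciprocal: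
  assumes N: "circle_measure N" and ne: "emeasure N UNIV \<noteq> 0"
    and recip: "\<And>z. norm z < 1 \<Longrightarrow> (Q N z + \<i> * of_real a) * (Q M z + \<i> * of_real b) = 1"
    and x: "norm x = 1"
    and lim: "((\<lambda>r. Im (Q N (of_real r * x))) \<longlongrightarrow> - a) (at_left 1)"
  shows "emeasure M {x} = inverse (4 * circle_measure.energy N x)"
proof -
  interpret N: circle_measure N by fact
  define R where "R n = real (Suc n) / real (Suc (Suc n))" for n
  have R: "\<And>n. 0 < R n" "\<And>n. R n < 1" "R \<longlonglongrightarrow> 1"
    using radial_seq by (auto simp: R_def[abs_def])
  have nR: "norm (of_real (R n) * x) = R n" for n using x R(1)[of n] by (simp add: norm_mult)
  define F where "F n = Q N (of_real (R n) * x) + \<i> * of_real a" for n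
  define G where "G n = Q M (of_real (R n) * x) + \<i> * of_real b" for n
  have FG: "F n * G n = 1" for n
    unfolding F_def G_def using nR R(2) by (intro recip) auto
  then have nz: "F n \<noteq> 0" "G n \<noteq> 0" for n by (metis mult_zero_left mult_zero_right zero_neq_one)+
  have at: "filterlim R (at_left 1) sequentially"
    by (intro tendsto_imp_filterlim_at_left R always_eventually allI)
  define m where "m = measure M {x}"
  have "(\<lambda>n. of_real ((1 - R n) / 2) * Q M (of_real (R n) * x) + of_real ((1 - R n) / 2) * (\<i> * of_real b))
      \<longlonglongrightarrow> of_real m + of_real ((1 - 1) / 2) * (\<i> * of_real b)"
    unfolding m_def by (intro tendsto_add point_mass_limit x R tendsto_intros) auto
  then have mlim: "(\<lambda>n. of_real ((1 - R n) / 2) * G n) \<longlonglongrightarrow> of_real m"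
    by (simp add: G_def distrib_left)
  have inv: "inverse (of_real ((1 - R n) / 2) * G n) = 2 * (F n / of_real (1 - R n))" for n
  proof -
    have "inverse (G n) = F n" using FG[of n] nz[of n] by (simp add: field_simps)
    then show ?thesis unfolding inverse_mult_distrib by (simp add: inverse_eq_divide)
  qed
  show ?thesis
  proof (cases "N.energy x = \<top>")
    case True
    have "m = 0"
    proof (rule ccontr)
      assume "m \<noteq> 0"
      then have "(\<lambda>n. inverse (of_real ((1 - R n) / 2) * G n)) \<longlonglongrightarrow> inverse (of_real m)"
        by (intro tendsto_inverse mlim) auto
      then have "Bseq (\<lambda>n. 2 * (F n / of_real (1 - R n)))"
        unfolding inv by (intro convergent_imp_Bseq convergentI)
      then obtain K where K: "\<forall>n. norm (2 * (F n / of_real (1 - R n))) \<le> K"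
        unfolding Bseq_def by blast
      have "N.energy x \<le> ennreal (K / 2)"
      proof (rule N.energy_le[OF x R])
        fix n
        have "Re (Q N (of_real (R n) * x)) = Re (F n)" by (simp add: F_def)
        also have "\<dots> \<le> norm (F n)" by (rule complex_Re_le_cmod)
        also have "\<dots> \<le> K / 2 * (1 - R n)"
          using spec[OF K, of n] R(2)[of n] by (simp add: norm_mult norm_divide field_simps del: of_real_diff)
        finally show "Re (Q N (of_real (R n) * x)) \<le> K / 2 * (1 - R n)" .
      qed
      then show False using True by (simp add: top_unique)
    qed
    then show ?thesis by (simp add: True m_def emeasure_eq_measure ennreal_mult_top)
  next
    case False
    then obtain h where h: "(\<lambda>n. Q N (of_real (R n) * x)) \<longlonglongrightarrow> \<i> * of_real h"
      "(\<lambda>n. (Q N (of_real (R n) * x) - \<i> * of_real h) / of_real (1 - R n)) \<longlonglongrightarrow> of_real (2 * enn2real (N.energy x))"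
      using N.Q_angular_derivative[OF x R] by (auto simp: less_top)
    have "h = - a"
    proof (rule LIMSEQ_unique)
      show "(\<lambda>n. Im (Q N (of_real (R n) * x))) \<longlonglongrightarrow> h" using tendsto_Im[OF h(1)] by simp
      show "(\<lambda>n. Im (Q N (of_real (R n) * x))) \<longlonglongrightarrow> - a" by (rule filterlim_compose[OF lim at])
    qed
    then have "(\<lambda>n. F n / of_real (1 - R n)) \<longlonglongrightarrow> of_real (2 * enn2real (N.energy x))"
      using h(2) by (simp add: F_def)
    then have lim2: "(\<lambda>n. 2 * (F n / of_real (1 - R n))) \<longlonglongrightarrow> 2 * of_real (2 * enn2real (N.energy x))"
      by (intro tendsto_intros)
    define I where "I = enn2real (N.energy x)"
    have eI: "N.energy x = ennreal I" "0 \<le> I" using False by (auto simp: I_def less_top)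
    have "N.energy x \<noteq> 0"
    proof
      assume "N.energy x = 0"
      then have "AE w in N. inverse (ennreal ((norm (w - x))\<^sup>2)) = 0"
        unfolding N.energy_def by (subst (asm) nn_integral_0_iff_AE) auto
      then have AE_F: "AE w in N. False" by eventually_elim simp
      then have "emeasure N (space N) = 0" by (use emeasure_eq_0_AE[of "\<lambda>_. True" N] AE_F in simp)
      then show False using ne by simp
    qed
    then have I: "I > 0" using eI by (auto simp: less_le)
    have "(\<lambda>n. inverse (2 * (F n / of_real (1 - R n)))) \<longlonglongrightarrow> inverse (2 * of_real (2 * I))"
      using I by (intro tendsto_inverse lim2[folded I_def]) auto
    moreover have "inverse (2 * (F n / of_real (1 - R n))) = of_real ((1 - R n) / 2) * G n" for n
      unfolding inv[symmetric] by simp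
    ultimately have "(\<lambda>n. of_real ((1 - R n) / 2) * G n) \<longlonglongrightarrow> inverse (2 * of_real (2 * I))"
      by (simp only:)
    with mlim have "complex_of_real m = inverse (2 * of_real (2 * I))" by (rule LIMSEQ_unique)
    also have "\<dots> = of_real (inverse (4 * I))" by simp
    finally have "m = inverse (4 * I)" by (simp only: of_real_eq_iff)
    moreover have "4 * ennreal I = ennreal (4 * I)" using I by (simp add: ennreal_mult')
    ultimately show ?thesis
      using I by (simp add: emeasure_eq_measure m_def eI inverse_ennreal)
  qed
qed

end

section \<open>Measurability of radial limits\<close>

lemma le_on_interval_if_le_on_rats:
  fixes f :: "real \<Rightarrow> real"
  assumes cont: "continuous_on {a<..<b} f" and le: "\<And>q::rat. a < real_of_rat q \<Longrightarrow> real_of_rat q < b \<Longrightarrow> f (real_of_rat q) \<le> c"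
    and r: "a < r" "r < b"
  shows "f r \<le> c"
proof (rule ccontr)
  assume "\<not> f r \<le> c"
  then have r': "r \<in> f -` {c<..} \<inter> {a<..<b}" using r by auto
  have "open (f -` {c<..} \<inter> {a<..<b})"
    using continuous_on_open_vimage[of "{a<..<b}" f] cont by auto
  then obtain e where e: "e > 0" "ball r e \<subseteq> f -` {c<..} \<inter> {a<..<b}"
    using r' by (meson open_contains_ball)
  obtain q where q: "r < real_of_rat q" "real_of_rat q < r + e" using of_rat_dense[of r "r + e"] e by auto
  then have "real_of_rat q \<in> ball r e" by (auto simp: dist_real_def)
  then have "f (real_of_rat q) > c" "a < real_of_rat q" "real_of_rat q < b" using e by auto
  then show False using le[of q] by simp
qed

text \<open>
  Where the limit does not exist, \<open>Lim\<close> has a fixed value that depends neither on \<open>u\<close> nor on the point.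
  The set where it exists is measurable because, by continuity in \<open>r\<close>, the Cauchy condition can be tested
  on rational radii.
\<close>
lemma borel_measurable_Lim_at_left:
  fixes u :: "real \<Rightarrow> 'a \<Rightarrow> real"
  assumes meas: "\<And>r. 0 < r \<Longrightarrow> r < 1 \<Longrightarrow> u r \<in> borel_measurable M"
    and cont: "\<And>x. x \<in> space M \<Longrightarrow> continuous_on {0<..<1} (\<lambda>r. u r x)"
  shows "(\<lambda>x. Lim (at_left 1) (\<lambda>r. u r x)) \<in> borel_measurable M"
proof -
  define v where "v r x = (if 0 < r \<and> r < 1 then u r x else 0)" for r x
  have [measurable]: "v r \<in> borel_measurable M" for r
    using meas[of r] unfolding v_def by (cases "0 < r \<and> r < 1") auto
  define t where "t n = real (Suc n) / real (Suc (Suc n))" for n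
  have t: "0 < t n" "t n < 1" "t \<longlonglongrightarrow> 1" for n
    using radial_seq by (auto simp: t_def[abs_def])
  have at: "filterlim t (at_left 1) sequentially"
    by (intro tendsto_imp_filterlim_at_left t always_eventually allI)
  define C where "C x \<longleftrightarrow> (\<forall>k::nat. \<exists>n::nat. \<forall>q::rat. \<forall>q'::rat.
     t n < real_of_rat q \<and> real_of_rat q < 1 \<and> t n < real_of_rat q' \<and> real_of_rat q' < 1 \<longrightarrow> \<bar>v (real_of_rat q) x - v (real_of_rat q') x\<bar> \<le> 1 / Suc k)" for x
  have ex: "(\<exists>l. ((\<lambda>r. u r x) \<longlongrightarrow> l) (at_left 1)) \<longleftrightarrow> C x" if x: "x \<in> space M" for x
  proof
    assume "\<exists>l. ((\<lambda>r. u r x) \<longlongrightarrow> l) (at_left 1)"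
    then obtain l where l: "((\<lambda>r. u r x) \<longlongrightarrow> l) (at_left 1)" ..
    have half: "\<bar>a - b\<bar> \<le> e" if "\<bar>a - l\<bar> < e / 2" "\<bar>b - l\<bar> < e / 2" for a b e :: real
      using that by linarith
    show "C x" unfolding C_def
    proof
      fix k :: nat
      have "\<forall>\<^sub>F r in at_left 1. dist (u r x) l < 1 / Suc k / 2" by (rule tendstoD[OF l]) simp
      then obtain b where b: "b < 1" "\<forall>r>b. r < 1 \<longrightarrow> dist (u r x) l < 1 / Suc k / 2"
        unfolding eventually_at_left_field by (elim exE conjE)
      have "\<forall>\<^sub>F n in sequentially. b < t n" using order_tendstoD(1)[OF t(3) b(1)] .
      then obtain n where n: "b < t n" by (auto simp: eventually_sequentially)
      show "\<exists>n. \<forall>q::rat. \<forall>q'::rat. t n < real_of_rat q \<and> real_of_rat q < 1 \<and> t n < real_of_rat q' \<and> real_of_rat q' < 1 \<longrightarrow>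
          \<bar>v (real_of_rat q) x - v (real_of_rat q') x\<bar> \<le> 1 / Suc k"
      proof (intro exI allI impI)
        fix q q' :: rat assume q: "t n < real_of_rat q \<and> real_of_rat q < 1 \<and> t n < real_of_rat q' \<and> real_of_rat q' < 1"
        then have "0 < real_of_rat q" "0 < real_of_rat q'" using t(1)[of n] by linarith+
        then have "v (real_of_rat q) x = u (real_of_rat q) x" "v (real_of_rat q') x = u (real_of_rat q') x"
          using q by (auto simp: v_def)
        moreover have "dist (u (real_of_rat q) x) l < 1 / Suc k / 2" "dist (u (real_of_rat q') x) l < 1 / Suc k / 2"
          using b(2) q n by auto
        ultimately show "\<bar>v (real_of_rat q) x - v (real_of_rat q') x\<bar> \<le> 1 / Suc k"
          using half[of "u (real_of_rat q) x" "1 / Suc k" "u (real_of_rat q') x"]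
          by (simp only: dist_real_def)
      qed
    qed
  next
    assume C: "C x"
    have "cauchy_filter (filtermap (\<lambda>r. u r x) (at_left 1))"
      unfolding cauchy_filter_metric_filtermap
    proof (intro allI impI)
      fix e :: real assume "e > 0"
      then obtain k where k: "1 / Suc k < e" using nat_approx_posE by blast
      obtain n where n: "\<And>q q'::rat. t n < real_of_rat q \<Longrightarrow> real_of_rat q < 1 \<Longrightarrow> t n < real_of_rat q' \<Longrightarrow> real_of_rat q' < 1 \<Longrightarrow>
          \<bar>v (real_of_rat q) x - v (real_of_rat q') x\<bar> \<le> 1 / Suc k"
        using C unfolding C_def by metis
      have n': "\<bar>u (real_of_rat q) x - u (real_of_rat q') x\<bar> \<le> 1 / Suc k"
        if "t n < real_of_rat q" "real_of_rat q < 1" "t n < real_of_rat q'" "real_of_rat q' < 1" for q q' :: rat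
      proof -
        have "0 < real_of_rat q" "0 < real_of_rat q'" using that t(1)[of n] by linarith+
        then show ?thesis using n[OF that] that by (simp add: v_def)
      qed
      have c: "continuous_on {t n<..<1} (\<lambda>r. u r x)"
        using t(1)[of n] by (intro continuous_on_subset[OF cont[OF x]]) auto
      have 1: "\<bar>u r x - u (real_of_rat q') x\<bar> \<le> 1 / Suc k"
        if "t n < r" "r < 1" "t n < real_of_rat q'" "real_of_rat q' < 1" for r and q' :: rat
        by (rule le_on_interval_if_le_on_rats[of "t n" 1 "\<lambda>r. \<bar>u r x - u (real_of_rat q') x\<bar>"])
          (use that n' in \<open>auto intro!: continuous_intros c\<close>)
      have 2: "\<bar>u r x - u s x\<bar> \<le> 1 / Suc k"
        if "t n < r" "r < 1" "t n < s" "s < 1" for r s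
        by (rule le_on_interval_if_le_on_rats[of "t n" 1 "\<lambda>s. \<bar>u r x - u s x\<bar>"])
          (use that 1 in \<open>auto intro!: continuous_intros c\<close>)
      show "\<exists>P. eventually P (at_left 1) \<and> (\<forall>r s. P r \<and> P s \<longrightarrow> dist (u r x) (u s x) < e)"
      proof (intro exI conjI allI impI)
        show "\<forall>\<^sub>F r in at_left 1. t n < r \<and> r < 1"
          using eventually_at_left_real[OF t(2)[of n]] by simp
        fix r s assume "(t n < r \<and> r < 1) \<and> (t n < s \<and> s < 1)"
        then show "dist (u r x) (u s x) < e" using 2[of r s] k by (simp add: dist_real_def)
      qed
    qed
    then have "\<exists>c. filtermap (\<lambda>r. u r x) (at_left 1) \<le> nhds c"
      by (rule cauchy_filter_complete_converges[of _ UNIV]) (auto simp: complete_UNIV filtermap_bot_iff)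
    then show "\<exists>l. ((\<lambda>r. u r x) \<longlongrightarrow> l) (at_left 1)" by (simp add: filterlim_def)
  qed
  \<comment> \<open>the value of \<open>Lim\<close> in the absence of a limit\<close>
  define c :: real where "c = (THE l. False)"
  have eq: "Lim (at_left 1) (\<lambda>r. u r x) = (if C x then lim (\<lambda>n. v (t n) x) else c)" if x: "x \<in> space M" for x
  proof (cases "C x")
    case True
    then obtain l where l: "((\<lambda>r. u r x) \<longlongrightarrow> l) (at_left 1)" using ex[OF x] by auto
    have "(\<lambda>n. v (t n) x) \<longlonglongrightarrow> l"
      using filterlim_compose[OF l at] t by (simp add: v_def)
    then have "lim (\<lambda>n. v (t n) x) = l" by (rule limI)
    moreover have "Lim (at_left 1) (\<lambda>r. u r x) = l" by (rule tendsto_Lim[OF _ l]) simp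
    ultimately show ?thesis using True by simp
  next
    case False
    then have "\<not> ((\<lambda>r. u r x) \<longlongrightarrow> l) (at_left 1)" for l using ex[OF x] by blast
    then show ?thesis using False by (simp add: t2_space_class.Lim_def c_def)
  qed
  have "Measurable.pred M C" unfolding C_def by measurable
  then have "(\<lambda>x. if C x then lim (\<lambda>n. v (t n) x) else c) \<in> borel_measurable M" by measurable
  then show ?thesis by (subst measurable_cong[OF eq]) auto
qed

section \<open>Countable sets\<close>

lemma emeasure_circle_uniform_singleton:
  assumes "norm x = 1" shows "emeasure circle_uniform {x} = 0"
proof -
  have le: "emeasure circle_uniform {x} \<le> ennreal (4 * (1 / Suc n))" for n :: nat
    by (rule order_trans[OF emeasure_mono emeasure_circle_uniform_ball_le[OF assms, of "1 / Suc n"]]) auto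
  have "(\<lambda>n. ennreal (4 * (1 / Suc n))) \<longlonglongrightarrow> ennreal (4 * 0)"
    by (intro tendsto_intros tendsto_ennrealI LIMSEQ_Suc lim_1_over_n)
  then have "emeasure circle_uniform {x} \<le> ennreal (4 * 0)"
    by (rule LIMSEQ_le_const) (use le in auto)
  then show ?thesis by simp
qed

lemma countable_null_set_circle_uniform:
  assumes "countable Z" "Z \<subseteq> sphere 0 1"
  shows "Z \<in> null_sets circle_uniform"
proof -
  have "(\<Union>x\<in>Z. {x}) \<in> null_sets circle_uniform"
    using assms by (intro null_sets_UN') (auto simp: null_sets_def emeasure_circle_uniform_singleton)
  then show ?thesis by simp
qed

lemma emeasure_Int_countable:
  assumes Z: "countable Z" and sets: "\<And>z. z \<in> Z \<Longrightarrow> {z} \<in> sets M"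
  shows "emeasure M (A \<inter> Z) = (\<Sum>\<^sub>\<infinity>z\<in>Z. emeasure M {z} * indicator A z)"
proof -
  define e where "e = to_nat_on Z"
  have inj: "inj_on e Z" unfolding e_def using Z by (rule inj_on_to_nat_on)
  define g where "g n = inv_into Z e n" for n
  have g: "g (e z) = z" if "z \<in> Z" for z using inj that by (simp add: g_def)
  define X where "X n = {z \<in> A \<inter> Z. e z = n}" for n
  have X: "X (e z) = {z} \<inter> A" if "z \<in> Z" for z using that inj by (auto simp: X_def inj_on_def)
  have X0: "X n = {}" if "n \<notin> e ` Z" for n using that by (auto simp: X_def)
  have Xs: "X n \<in> sets M" for n
  proof (cases "n \<in> e ` Z")
    case True
    then obtain z where z: "z \<in> Z" "n = e z" by auto
    then show ?thesis using X[OF z(1)] sets[OF z(1)] by (cases "z \<in> A") auto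
  qed (simp add: X0)
  let ?f = "\<lambda>z. emeasure M {z} * indicator A z"
  have "infsum ?f Z = infsum (?f \<circ> g \<circ> e) Z" by (intro infsum_cong) (simp add: g)
  also have "\<dots> = infsum (?f \<circ> g) (e ` Z)" by (rule infsum_reindex[OF inj, symmetric])
  also have "\<dots> = infsum (\<lambda>n. emeasure M (X n)) UNIV"
  proof (rule infsum_cong_neutral)
    fix n assume "n \<in> e ` Z \<inter> UNIV"
    then obtain z where z: "z \<in> Z" "n = e z" by auto
    then show "(?f \<circ> g) n = emeasure M (X n)" by (cases "z \<in> A") (auto simp: g X)
  qed (auto simp: X0)
  also have "\<dots> = (\<Sum>n. emeasure M (X n))"
    by (intro sums_unique has_sum_imp_sums has_sum_infsum nonneg_summable_on_complete) simp
  also have "\<dots> = emeasure M (\<Union>n. X n)"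
    by (rule suminf_emeasure) (use Xs in \<open>auto simp: disjoint_family_on_def X_def\<close>)
  also have "(\<Union>n. X n) = A \<inter> Z" by (auto simp: X_def)
  finally show ?thesis ..
qed

lemma discrete_set_countable:
  assumes "discrete_set S" shows "countable S"
proof -
  obtain B :: "complex set set" where B: "countable B" "topological_basis B"
    using ex_countable_basis by blast
  have "\<exists>U\<in>B. U \<inter> S = {x}" if x: "x \<in> S" for x
  proof -
    obtain e where e: "e > 0" "\<And>y. y \<in> S \<Longrightarrow> y \<noteq> x \<Longrightarrow> dist x y > e"
      using assms x by (auto simp: discrete_set_def)
    obtain U where U: "U \<in> B" "x \<in> U" "U \<subseteq> ball x e"
      using topological_basisE[OF B(2) open_ball, of x x e] e(1) by auto
    have "U \<inter> S = {x}" using U e(2) x by fastforce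
    then show ?thesis using U(1) by blast
  qed
  then obtain f where f: "\<And>x. x \<in> S \<Longrightarrow> f x \<in> B" "\<And>x. x \<in> S \<Longrightarrow> f x \<inter> S = {x}" by metis
  have "inj_on f S" by (rule inj_onI) (metis f(2) singleton_inject)
  moreover have "countable (f ` S)" using f(1) by (intro countable_subset[OF _ B(1)]) auto
  ultimately show ?thesis by (rule countable_image_inj_on[rotated])
qed

lemma discrete_set_subset: "discrete_set S \<Longrightarrow> T \<subseteq> S \<Longrightarrow> discrete_set T"
  unfolding discrete_set_def by (meson subsetD)

section \<open>Measures on the Borel sets of the circle\<close>

text \<open>
  The push-forward along the inclusion of the circle into the plane, which satisfies the assumptions of
  the locale \<open>circle_measure\<close> and has the same Herglotz integral.
\<close>
definition planar :: "complex measure \<Rightarrow> complex measure" where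
  "planar lam = distr lam borel (\<lambda>w. w)"

lemma sphere_borel [measurable, simp]: "sphere (0::complex) 1 \<in> sets borel"
  by (intro borel_closed) simp

lemma sets_circle_borel_iff: "A \<in> sets circle_borel \<longleftrightarrow> A \<subseteq> sphere 0 1 \<and> A \<in> sets borel"
  unfolding circle_borel_def by (subst sets_restrict_space_iff) auto

lemma space_circle_borel: "space circle_borel = sphere 0 1"
  by (simp add: circle_borel_def space_restrict_space)

lemma inclusion_measurable:
  assumes "sets lam = sets circle_borel"
  shows "(\<lambda>w. w) \<in> borel_measurable lam"
  unfolding measurable_cong_sets[OF assms refl] circle_borel_def
  by (rule measurable_restrict_space1) simp

lemma space_eq_sphere:
  assumes "sets lam = sets circle_borel" shows "space lam = sphere 0 1"
  using sets_eq_imp_space_eq[OF assms] by (simp add: space_circle_borel)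

lemma emeasure_planar:
  assumes "sets lam = sets circle_borel" "A \<in> sets borel"
  shows "emeasure (planar lam) A = emeasure lam (A \<inter> sphere 0 1)"
  unfolding planar_def using assms(2) inclusion_measurable[OF assms(1)]
  by (subst emeasure_distr) (auto simp: space_eq_sphere[OF assms(1)])

lemma nn_integral_planar:
  assumes "sets lam = sets circle_borel" "f \<in> borel_measurable borel"
  shows "(\<integral>\<^sup>+w. f w \<partial>planar lam) = (\<integral>\<^sup>+w. f w \<partial>lam)"
  unfolding planar_def using assms by (subst nn_integral_distr[OF inclusion_measurable]) auto

lemma circle_measure_planar:
  assumes "sets lam = sets circle_borel" "finite_measure lam"
  shows "circle_measure (planar lam)"
proof (intro circle_measure.intro circle_measure_axioms.intro)
  interpret finite_measure lam by fact
  show "finite_measure (planar lam)"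
    unfolding planar_def by (rule finite_measure_distr[OF inclusion_measurable[OF assms(1)]])
  show "sets (planar lam) = sets borel" by (simp add: planar_def)
  have "{w::complex. norm w = 1} \<in> sets borel"
    by (intro borel_closed closed_Collect_eq continuous_intros)
  then show "AE w in planar lam. norm w = 1"
    unfolding planar_def using inclusion_measurable[OF assms(1)]
    by (subst AE_distr_iff) (auto simp: space_eq_sphere[OF assms(1)])
qed

lemma Q_planar:
  assumes "sets lam = sets circle_borel"
  shows "Q (planar lam) z = Q lam z"
  unfolding Q_def planar_def
  by (rule integral_distr[OF inclusion_measurable[OF assms]]) measurable

lemma sets_circle_lebesgue [simp]: "sets circle_lebesgue = sets circle_borel"
  by (simp add: circle_lebesgue_def)

lemma planar_circle_lebesgue: "planar circle_lebesgue = circle_uniform"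
proof -
  have "cis \<in> measurable (uniform_measure lborel {0..<2 * pi}) circle_borel"
    unfolding circle_borel_def by (rule measurable_restrict_space2) auto
  then show ?thesis
    unfolding planar_def circle_lebesgue_def circle_uniform_def
    by (subst distr_distr) (auto intro: inclusion_measurable simp: o_def)
qed

lemma AE_circle_lebesgueI:
  assumes "AE x in circle_uniform. P x" shows "AE x in circle_lebesgue. P x"
  using AE_distrD[OF inclusion_measurable[OF sets_circle_lebesgue], of P] assms
  unfolding planar_circle_lebesgue[symmetric] planar_def by simp

lemma ac_density_planar:
  assumes lam: "sets lam = sets circle_borel" and f: "is_ac_density lam f"
  defines "g \<equiv> \<lambda>z. ennreal (f z) * indicator (sphere 0 1) z"
  obtains N where "N \<in> null_sets circle_uniform" "g \<in> borel_measurable borel"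
    "density (planar lam) (indicator (- N)) = density circle_uniform g"
proof -
  note lam' = inclusion_measurable[OF lam]
  obtain s N where s: "sets s = sets circle_borel" "N \<in> null_sets circle_lebesgue" "emeasure s (space s - N) = 0"
    "\<And>A. A \<in> sets circle_borel \<Longrightarrow> emeasure lam A = (\<integral>\<^sup>+z\<in>A. ennreal (f z) \<partial>circle_lebesgue) + emeasure s A"
    using f by (auto simp: is_ac_density_def)
  have f_meas [measurable]: "f \<in> borel_measurable circle_lebesgue" using f by (auto simp: is_ac_density_def)
  have "(\<lambda>z. ennreal (f z)) \<in> borel_measurable circle_lebesgue" by measurable
  then have g: "g \<in> borel_measurable borel"
    unfolding g_def measurable_cong_sets[OF sets_circle_lebesgue refl] circle_borel_def
    by (subst (asm) borel_measurable_restrict_space_iff_ennreal) auto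
  have N: "N \<subseteq> sphere 0 1" "N \<in> sets borel"
    using s(2) by (auto simp: null_sets_def sets_circle_borel_iff)
  have N': "N \<in> null_sets circle_uniform"
  proof -
    have "emeasure circle_uniform N = emeasure circle_lebesgue (N \<inter> sphere 0 1)"
      unfolding planar_circle_lebesgue[symmetric] by (rule emeasure_planar) (use N in simp_all)
    also have "N \<inter> sphere 0 1 = N" using N by auto
    finally show ?thesis using s(2) N by (simp add: null_sets_def)
  qed
  have "density (planar lam) (indicator (- N)) = density circle_uniform g"
  proof (rule measure_eqI)
    show "sets (density (planar lam) (indicator (- N))) = sets (density circle_uniform g)"
      by (simp add: planar_def)
    fix A assume "A \<in> sets (density (planar lam) (indicator (- N)))"
    then have A [measurable]: "A \<in> sets borel" by (simp add: planar_def)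
    let ?B = "(A - N) \<inter> sphere 0 1"
    have B: "?B \<in> sets circle_borel" using A N by (auto simp: sets_circle_borel_iff)
    have "- N \<inter> A = A - N" by auto
    moreover have "- N \<in> sets (planar lam)" using N by (simp add: planar_def)
    ultimately have "emeasure (density (planar lam) (indicator (- N))) A = emeasure (planar lam) (A - N)"
      using A by (subst emeasure_restricted) (simp_all add: planar_def)
    also have "\<dots> = emeasure lam ?B" by (rule emeasure_planar[OF lam]) (use A N in simp)
    also have "\<dots> = (\<integral>\<^sup>+z\<in>?B. ennreal (f z) \<partial>circle_lebesgue) + emeasure s ?B" by (rule s(4)[OF B])
    also have "emeasure s ?B = 0"
    proof -
      have "emeasure s ?B \<le> emeasure s (space s - N)"
        using s(2) N by (intro emeasure_mono) (auto simp: space_eq_sphere[OF s(1)] s(1) sets_circle_borel_iff)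
      then show ?thesis using s(3) by simp
    qed
    also have "(\<integral>\<^sup>+z\<in>?B. ennreal (f z) \<partial>circle_lebesgue) = (\<integral>\<^sup>+z. g z * indicator (A - N) z \<partial>circle_lebesgue)"
      by (intro nn_integral_cong) (auto simp: g_def indicator_def)
    also have "\<dots> = (\<integral>\<^sup>+z. g z * indicator (A - N) z \<partial>circle_uniform)"
      unfolding planar_circle_lebesgue[symmetric]
      using g A N by (intro nn_integral_planar[symmetric]) auto
    also have "\<dots> = (\<integral>\<^sup>+z. g z * indicator A z \<partial>circle_uniform)"
      by (rule nn_integral_cong_AE) (use AE_not_in[OF N'] in \<open>auto simp: indicator_def\<close>)
    also have "\<dots> = emeasure (density circle_uniform g) A"
      using g by (subst emeasure_density) auto
    finally show "emeasure (density (planar lam) (indicator (- N))) A = emeasure (density circle_uniform g) A"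
      by simp
  qed
  then show ?thesis using N' g that by blast
qed

text \<open>
  The squared chord \<open>\<bar>w - x\<bar>\<^sup>2\<close> is \<open>4 * sin\<^sup>2\<close> of the half angle. At \<open>w = x\<close> both integrands are infinite.
\<close>
lemma beta_eq_energy:
  assumes lam: "sets lam = sets circle_borel" "finite_measure lam" and x: "norm x = 1"
  shows "beta lam x = inverse (4 * circle_measure.energy (planar lam) x)"
proof -
  interpret circle_measure "planar lam" by (rule circle_measure_planar) fact+
  have eq: "inverse (ennreal ((sin ((Arg w - Arg x) / 2))\<^sup>2)) = 4 * inverse (ennreal ((norm (w - x))\<^sup>2))"
    if w: "norm w = 1" for w
  proof -
    define s where "s = (sin ((Arg w - Arg x) / 2))\<^sup>2"
    have "w = cis (Arg w)" "x = cis (Arg x)" using w x by (metis rcis_cmod_Arg rcis_def mult_1 of_real_1)+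
    then have n: "(norm (w - x))\<^sup>2 = 4 * s"
      using norm_cis_diff_squared[of "Arg w" "Arg x"] by (simp add: s_def power_mult_distrib)
    have s0: "s \<ge> 0" by (simp add: s_def)
    show ?thesis
      unfolding n s_def[symmetric]
    proof (cases "s = 0")
      case True
      then show "inverse (ennreal s) = 4 * inverse (ennreal (4 * s))" by (simp add: ennreal_mult_top)
    next
      case False
      then have "s > 0" using s0 by simp
      then show "inverse (ennreal s) = 4 * inverse (ennreal (4 * s))"
        by (simp add: inverse_ennreal ennreal_mult'[symmetric] flip: ennreal_numeral)
    qed
  qed
  have "(\<integral>\<^sup>+w. inverse (ennreal ((sin ((Arg w - Arg x) / 2))\<^sup>2)) \<partial>lam)
      = (\<integral>\<^sup>+w. 4 * inverse (ennreal ((norm (w - x))\<^sup>2)) \<partial>lam)"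
    using eq by (intro nn_integral_cong) (auto simp: space_eq_sphere[OF lam(1)])
  also have "\<dots> = (\<integral>\<^sup>+w. 4 * inverse (ennreal ((norm (w - x))\<^sup>2)) \<partial>planar lam)"
    by (rule nn_integral_planar[OF lam(1), symmetric]) measurable
  also have "\<dots> = 4 * energy x" unfolding energy_def by (rule nn_integral_cmult) measurable
  finally show ?thesis by (simp add: beta_def)
qed

text \<open>
  An arc of half-length \<open>\<delta>\<close> around \<open>x\<close> lies in the ball of radius \<open>\<delta>\<close>, whose measure is at most
  \<open>4 * \<delta>\<close> times the Poisson integral at distance \<open>\<delta>\<close> from the circle. So the density of the measure at
  \<open>x\<close> vanishes, and \<open>x\<close> lies in each of the sets whose closures are intersected.
\<close>
lemma zero_set_of_poisson_tendsto_0: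
  assumes lam: "sets lam = sets circle_borel" "finite_measure lam" and x: "norm x = 1"
    and lim: "((\<lambda>r. poisson (planar lam) (of_real r * x)) \<longlongrightarrow> 0) (at_left 1)"
  shows "x \<in> zero_set lam"
proof -
  interpret circle_measure "planar lam" by (rule circle_measure_planar) fact+
  define t where "t = Arg x"
  have xt: "x = cis t" using x unfolding t_def by (metis rcis_cmod_Arg rcis_def mult_1 of_real_1)
  let ?g = "\<lambda>\<delta>. emeasure lam (cis ` {t - \<delta>..t + \<delta>}) / ennreal (2 * \<delta>)"
  let ?p = "\<lambda>\<delta>. poisson (planar lam) (of_real (1 - \<delta>) * x)"
  have ev: "\<forall>\<^sub>F \<delta> in at_right 0. 0 < \<delta> \<and> \<delta> < (1::real)"
    using eventually_at_right_real[of 0 1] by simp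
  have le: "\<forall>\<^sub>F \<delta> in at_right 0. ?g \<delta> \<le> 2 * ?p \<delta>"
    using ev
  proof eventually_elim
    case (elim \<delta>)
    have "compact (cis ` {t - \<delta>..t + \<delta>})"
      by (intro compact_continuous_image continuous_intros) auto
    then have b: "cis ` {t - \<delta>..t + \<delta>} \<in> sets borel" by (intro borel_closed compact_imp_closed)
    have "cis ` {t - \<delta>..t + \<delta>} \<inter> sphere 0 1 = cis ` {t - \<delta>..t + \<delta>}" by auto
    then have "emeasure lam (cis ` {t - \<delta>..t + \<delta>}) = emeasure (planar lam) (cis ` {t - \<delta>..t + \<delta>})"
      using emeasure_planar[OF lam(1) b] by simp
    also have "\<dots> \<le> emeasure (planar lam) (cball x (1 - (1 - \<delta>)))"
    proof (intro emeasure_mono subsetI)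
      fix y assume "y \<in> cis ` {t - \<delta>..t + \<delta>}"
      then obtain u where u: "y = cis u" "\<bar>t - u\<bar> \<le> \<delta>" by (auto simp: abs_le_iff)
      then show "y \<in> cball x (1 - (1 - \<delta>))" using norm_cis_diff_le[of t u] by (simp add: xt dist_norm)
    qed simp
    also have "\<dots> \<le> ennreal (4 * (1 - (1 - \<delta>))) * ?p \<delta>"
      using elim by (intro emeasure_cball_le_poisson x) auto
    also have "ennreal (4 * (1 - (1 - \<delta>))) = 2 * ennreal (2 * \<delta>)"
      using elim by (simp add: ennreal_mult'[symmetric] flip: ennreal_numeral)
    finally have "?g \<delta> \<le> 2 * ennreal (2 * \<delta>) * ?p \<delta> / ennreal (2 * \<delta>)" by (rule divide_right_mono_ennreal)
    also have "2 * ennreal (2 * \<delta>) * ?p \<delta> = 2 * ?p \<delta> * ennreal (2 * \<delta>)" by (simp only: mult_ac)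
    also have "\<dots> / ennreal (2 * \<delta>) = 2 * ?p \<delta>" using elim by (intro ennreal_mult_divide_eq) auto
    finally show ?case .
  qed
  have "filterlim (\<lambda>\<delta>. 1 - \<delta>) (at_left 1) (at_right (0::real))"
  proof (rule tendsto_imp_filterlim_at_left)
    have "((\<lambda>\<delta>. 1 - \<delta>) \<longlongrightarrow> 1 - 0) (at_right (0::real))" by (intro tendsto_intros)
    then show "((\<lambda>\<delta>. 1 - \<delta>) \<longlongrightarrow> 1) (at_right (0::real))" by simp
    show "\<forall>\<^sub>F \<delta> in at_right 0. 1 - \<delta> < (1::real)" using ev by eventually_elim simp
  qed
  then have "(?p \<longlongrightarrow> 0) (at_right 0)" by (rule filterlim_compose[OF lim])
  then have "((\<lambda>\<delta>. 2 * ?p \<delta>) \<longlongrightarrow> 2 * 0) (at_right 0)" by (intro ennreal_tendsto_cmult) auto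
  then have "(?g \<longlongrightarrow> 0) (at_right 0)"
    by (intro tendsto_sandwich[OF _ le tendsto_const]) auto
  then have "Limsup (at_right 0) ?g = 0" by (intro lim_imp_Limsup) auto
  then have "x \<in> closure {cis \<theta> | \<theta>::real.
     Limsup (at_right 0) (\<lambda>\<delta>. emeasure lam (cis ` {\<theta> - \<delta>..\<theta> + \<delta>}) / ennreal (2 * \<delta>)) < ennreal \<epsilon>}"
    if "\<epsilon> > 0" for \<epsilon>
    using that by (intro closure_subset[THEN subsetD]) (auto simp: xt intro!: exI[of _ t])
  then show ?thesis unfolding zero_set_def by blast
qed

lemma H_measurable:
  assumes lam: "sets lam = sets circle_borel" "finite_measure lam"
  shows "H lam \<in> borel_measurable circle_borel"
proof -
  interpret circle_measure "planar lam" by (rule circle_measure_planar) fact+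
  have cont: "continuous_on (ball 0 1) (Q lam)"
    using holomorphic_on_imp_continuous_on[OF Q_holomorphic] Q_planar[OF lam(1)] by (simp cong: continuous_on_cong)
  show ?thesis
    unfolding H_def
  proof (rule borel_measurable_Lim_at_left)
    fix r :: real assume r: "0 < r" "r < 1"
    have "continuous_on (sphere 0 1) (\<lambda>x. Im (Q lam (of_real r * x)))"
      by (intro continuous_intros continuous_on_compose2[OF cont]) (use r in \<open>auto simp: norm_mult\<close>)
    then show "(\<lambda>x. Im (Q lam (of_real r * x))) \<in> borel_measurable circle_borel"
      unfolding circle_borel_def by (rule borel_measurable_continuous_on_restrict)
  next
    fix x assume "x \<in> space circle_borel"
    then show "continuous_on {0<..<1} (\<lambda>r. Im (Q lam (of_real r * x)))"
      by (intro continuous_intros continuous_on_compose2[OF cont]) (auto simp: norm_mult space_circle_borel)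
  qed
qed

section \<open>The reciprocal measure\<close>

theorem theorem4p3:
  fixes lam mu :: "complex measure" and c0 \<zeta>0 :: real
    and lam_c mu_c :: "complex \<Rightarrow> real" and Z Z' :: "complex set"
  assumes "lam \<in> M_plus"
    and "Z' = (zero_set lam \<inter> supp lam) \<union> {z \<in> sphere 0 1 - supp lam. z \<in> H_level lam c0}"
    and "discrete_set Z'"
    and "is_ac_density lam lam_c"
    and "B_rel (lam, c0) (mu, \<zeta>0)"
    and "mu_c = (\<lambda>z. lam_c z / ((lam_c z)\<^sup>2 + (H lam z + c0)\<^sup>2))"
    and "Z = zero_set lam \<inter> H_level lam c0"
  shows "integrable circle_lebesgue mu_c \<and>
      Z \<subseteq> Z' \<and> discrete_set Z \<and>
    (\<forall>A\<in>sets circle_borel. emeasure mu A =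
           (\<integral>\<^sup>+z\<in>A. ennreal (mu_c z) \<partial>circle_lebesgue) +
           (\<Sum>\<^sub>\<infinity>\<zeta>\<in>Z. beta lam \<zeta> * emeasure (return circle_borel \<zeta>) A)) \<and>
    \<zeta>0 = Im (inverse (of_real (total_mass lam) + \<i> * of_real c0))"
proof -
  have lam: "sets lam = sets circle_borel" "finite_measure lam" "emeasure lam (space lam) \<noteq> 0"
    using assms(1) by (auto simp: M_plus_def)
  have mu: "sets mu = sets circle_borel" "finite_measure mu"
    using assms(5) by (auto simp: B_rel_def M_plus_def)
  interpret L: circle_measure "planar lam" by (rule circle_measure_planar[OF lam(1,2)])
  interpret M: circle_measure "planar mu" by (rule circle_measure_planar[OF mu])
  note Q = Q_planar[OF lam(1)] Q_planar[OF mu(1)]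
  have recip: "(Q (planar lam) z + \<i> * of_real c0) * (Q (planar mu) z + \<i> * of_real \<zeta>0) = 1"
    if "norm z < 1" for z
    using assms(5) that by (simp add: B_rel_def Q_shift_def Q)
  have lam_ne: "emeasure (planar lam) UNIV \<noteq> 0"
    using lam by (simp add: emeasure_planar space_eq_sphere)
  have disc: "norm (of_real r * x) < 1" if "r \<in> {0<..<1}" "norm x = 1" for r and x :: complex
    using that by (simp add: norm_mult)
  have unit: "\<forall>\<^sub>F r in at_left 1. r \<in> {0<..<1::real}"
    using eventually_at_left_real[of 0 1] by simp

  have Z_sub: "Z \<subseteq> Z'" using assms(2,7) by (auto simp: H_level_def)
  then have Z_disc: "discrete_set Z" using assms(3) by (rule discrete_set_subset[rotated])
  have Z_count: "countable Z" by (rule discrete_set_countable[OF Z_disc])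
  have Z_sphere: "Z \<subseteq> sphere 0 1" using assms(7) by (auto simp: H_level_def)
  have Z_null: "Z \<in> null_sets circle_uniform" by (rule countable_null_set_circle_uniform[OF Z_count Z_sphere])
  then have Z_borel: "Z \<in> sets borel" by (simp add: null_sets_def)

  \<comment> \<open>evaluate the defining identity at the origin\<close>
  have total: "\<zeta>0 = Im (inverse (of_real (total_mass lam) + \<i> * of_real c0))"
  proof -
    have Q0: "Q nu 0 = of_real (total_mass nu)" for nu by (simp add: Q_def total_mass_def scaleR_conv_of_real)
    have "(of_real (total_mass lam) + \<i> * of_real c0) * (of_real (total_mass mu) + \<i> * of_real \<zeta>0) = 1"
      using recip[of 0] unfolding Q by (simp add: Q0)
    then have "inverse (of_real (total_mass lam) + \<i> * of_real c0) = of_real (total_mass mu) + \<i> * of_real \<zeta>0"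
      by (rule inverse_unique)
    then show ?thesis by simp
  qed

  obtain N where N: "N \<in> null_sets circle_uniform"
    "(\<lambda>z. ennreal (lam_c z) * indicator (sphere 0 1) z) \<in> borel_measurable borel"
    "density (planar lam) (indicator (- N)) = density circle_uniform (\<lambda>z. ennreal (lam_c z) * indicator (sphere 0 1) z)"
    by (rule ac_density_planar[OF lam(1) assms(4)])
  obtain S g where S: "S \<in> null_sets circle_uniform" "g \<in> borel_measurable borel"
    "density (planar mu) (indicator (- S)) = density circle_uniform g"
    by (rule M.Lebesgue_decomposition)
  have S_borel: "S \<in> sets borel" using S(1) by (simp add: null_sets_def)
  note [measurable] = S_borel Z_borel S(2)

  \<comment> \<open>both Herglotz integrals have finite boundary values, whose product with shifts is 1; so the one
      for \<open>lam\<close> is not zero, and the density \<open>g\<close> is the real part of its reciprocal\<close>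
  have g_eq: "AE x in circle_lebesgue. 0 \<le> mu_c x \<and> g x = ennreal (mu_c x)"
  proof -
    have "AE x in circle_lebesgue. 0 \<le> lam_c x" using assms(4) by (simp add: is_ac_density_def)
    with AE_circle_lebesgueI[OF L.AE_Re_Q_tendsto[OF N]]
      AE_circle_lebesgueI[OF M.AE_Re_Q_tendsto[OF S]]
      AE_circle_lebesgueI[OF L.AE_Q_convergent] AE_circle_lebesgueI[OF M.AE_Q_convergent]
      AE_circle_lebesgueI[OF circle_uniform.AE_circle]
    show ?thesis
    proof eventually_elim
      case (elim x)
      obtain l where l: "((\<lambda>r. Q (planar lam) (of_real r * x)) \<longlongrightarrow> l) (at_left 1)" using elim(3) ..
      obtain l' where l': "((\<lambda>r. Q (planar mu) (of_real r * x)) \<longlongrightarrow> l') (at_left 1)" using elim(4) ..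
      have "enn2real (ennreal (lam_c x) * indicator (sphere 0 1) x) = lam_c x" using elim(5,6) by simp
      then have Re_l: "Re l = lam_c x"
        using tendsto_unique[OF _ tendsto_Re[OF l]] elim(1) by auto
      have Re_l': "Re l' = enn2real (g x)"
        using tendsto_unique[OF _ tendsto_Re[OF l']] elim(2) by auto
      have "((\<lambda>r. Im (Q lam (of_real r * x))) \<longlongrightarrow> Im l) (at_left 1)" using tendsto_Im[OF l] by (simp add: Q)
      then have Im_l: "H lam x = Im l" unfolding H_def by (intro tendsto_Lim) simp_all
      have "((\<lambda>r. (Q (planar lam) (of_real r * x) + \<i> * of_real c0) * (Q (planar mu) (of_real r * x) + \<i> * of_real \<zeta>0))
          \<longlongrightarrow> (l + \<i> * of_real c0) * (l' + \<i> * of_real \<zeta>0)) (at_left 1)"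
        by (intro tendsto_intros l l')
      moreover have "((\<lambda>r. (Q (planar lam) (of_real r * x) + \<i> * of_real c0) * (Q (planar mu) (of_real r * x) + \<i> * of_real \<zeta>0))
          \<longlongrightarrow> 1) (at_left 1)"
      proof (rule tendsto_eventually)
        show "\<forall>\<^sub>F r in at_left 1. (Q (planar lam) (of_real r * x) + \<i> * of_real c0) *
            (Q (planar mu) (of_real r * x) + \<i> * of_real \<zeta>0) = 1"
          using unit by eventually_elim (use recip disc elim(5) in blast)
      qed
      ultimately have "(l + \<i> * of_real c0) * (l' + \<i> * of_real \<zeta>0) = 1"
        by (intro tendsto_unique[where F="at_left (1::real)"]) simp_all
      then have "inverse (l + \<i> * of_real c0) = l' + \<i> * of_real \<zeta>0" by (rule inverse_unique)
      then have "Re (inverse (l + \<i> * of_real c0)) = enn2real (g x)" by (simp add: Re_l')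
      then have "mu_c x = enn2real (g x)" by (simp add: assms(6) Re_l Im_l)
      then show ?case using elim(2) by (simp add: less_top)
    qed
  qed

  have meas: "mu_c \<in> borel_measurable circle_lebesgue"
  proof -
    have [measurable]: "lam_c \<in> borel_measurable circle_lebesgue" using assms(4) by (auto simp: is_ac_density_def)
    have [measurable]: "H lam \<in> borel_measurable circle_lebesgue"
      using H_measurable[OF lam(1,2)] by (simp cong: measurable_cong_sets)
    show ?thesis unfolding assms(6) by measurable
  qed
  have ac: "emeasure (planar mu) (A - S) = (\<integral>\<^sup>+z\<in>A. ennreal (mu_c z) \<partial>circle_lebesgue)"
    if [measurable]: "A \<in> sets borel" for A
  proof -
    have "emeasure (planar mu) (A - S) = emeasure (density (planar mu) (indicator (- S))) A"
      by (subst emeasure_restricted) (auto simp: Diff_eq Int_commute)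
    also have "\<dots> = (\<integral>\<^sup>+z. g z * indicator A z \<partial>circle_uniform)" unfolding S(3) by (rule emeasure_density) auto
    also have "\<dots> = (\<integral>\<^sup>+z. g z * indicator A z \<partial>circle_lebesgue)"
      unfolding planar_circle_lebesgue[symmetric] by (rule nn_integral_planar) auto
    also have "\<dots> = (\<integral>\<^sup>+z\<in>A. ennreal (mu_c z) \<partial>circle_lebesgue)"
      by (rule nn_integral_cong_AE) (use g_eq in eventually_elim, simp)
    finally show ?thesis .
  qed
  have int: "integrable circle_lebesgue mu_c"
  proof (rule integrableI_nonneg[OF meas])
    show "AE x in circle_lebesgue. 0 \<le> mu_c x" using g_eq by eventually_elim simp
    have "(\<integral>\<^sup>+z. ennreal (mu_c z) \<partial>circle_lebesgue) = emeasure (planar mu) (UNIV - S)" by (simp add: ac)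
    also have "\<dots> < \<infinity>" by (simp add: M.emeasure_finite flip: less_top)
    finally show "(\<integral>\<^sup>+z. ennreal (mu_c z) \<partial>circle_lebesgue) < \<infinity>" .
  qed

  \<comment> \<open>the singular part lives where \<open>Q mu\<close> blows up, that is, where \<open>Q lam + \<i> * c0\<close> tends to 0\<close>
  have sing: "AE x in planar mu. x \<in> S \<longrightarrow> x \<in> Z"
    using M.AE_poisson_tendsto_top[OF S(1)] M.AE_circle
  proof eventually_elim
    case (elim x)
    show ?case
    proof
      assume "x \<in> S"
      let ?F = "\<lambda>r. Q (planar lam) (of_real r * x) + \<i> * of_real c0"
      let ?G = "\<lambda>r. Q (planar mu) (of_real r * x) + \<i> * of_real \<zeta>0"
      have top: "((\<lambda>r. poisson (planar mu) (of_real r * x)) \<longlongrightarrow> \<top>) (at_left 1)" using elim \<open>x \<in> S\<close> by blast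
      have "filterlim (\<lambda>r. norm (?G r)) at_top (at_left 1)"
        unfolding filterlim_at_top
      proof
        fix C :: real
        have "\<forall>\<^sub>F r in at_left 1. ennreal C < poisson (planar mu) (of_real r * x)"
          by (rule order_tendstoD(1)[OF top]) simp
        then show "\<forall>\<^sub>F r in at_left 1. C \<le> norm (?G r)" using unit
        proof eventually_elim
          case (elim r)
          then have n: "norm (of_real r * x) < 1" using disc \<open>norm x = 1\<close> by blast
          then have "C < Re (Q (planar mu) (of_real r * x))"
            using elim(1) M.Re_Q_nonneg[OF n] unfolding M.poisson_eq[OF n]
            by (metis ennreal_leI not_le)
          also have "\<dots> = Re (?G r)" by simp
          also have "\<dots> \<le> norm (?G r)" by (rule complex_Re_le_cmod)
          finally show ?case by simp
        qed
      qed
      then have "((\<lambda>r. inverse (norm (?G r))) \<longlongrightarrow> 0) (at_left 1)" by (rule tendsto_inverse_0_at_top)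
      moreover have "\<forall>\<^sub>F r in at_left 1. inverse (norm (?G r)) = norm (?F r)"
        using unit
      proof eventually_elim
        case (elim r)
        then have "norm (of_real r * x) < 1" using disc \<open>norm x = 1\<close> by blast
        then have "?G r * ?F r = 1" using recip by (simp add: mult.commute)
        then have "inverse (?G r) = ?F r" by (rule inverse_unique)
        then show ?case by (metis norm_inverse)
      qed
      ultimately have "((\<lambda>r. norm (?F r)) \<longlongrightarrow> 0) (at_left 1)" by (rule Lim_transform_eventually)
      then have F0: "(?F \<longlongrightarrow> 0) (at_left 1)" by (rule tendsto_norm_zero_cancel)
      have Re0: "((\<lambda>r. Re (Q (planar lam) (of_real r * x))) \<longlongrightarrow> 0) (at_left 1)"
        using tendsto_Re[OF F0] by simp
      have "((\<lambda>r. Im (?F r) - c0) \<longlongrightarrow> Im 0 - c0) (at_left 1)" by (intro tendsto_intros F0)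
      then have h: "has_H lam x (- c0)" by (simp add: has_H_def Q)
      then have "H lam x = - c0" unfolding H_def has_H_def by (intro tendsto_Lim) simp_all
      then have "x \<in> H_level lam c0" using h \<open>norm x = 1\<close> by (auto simp: H_level_def)
      moreover have "((\<lambda>r. poisson (planar lam) (of_real r * x)) \<longlongrightarrow> 0) (at_left 1)"
      proof (rule Lim_transform_eventually)
        show "((\<lambda>r. ennreal (Re (Q (planar lam) (of_real r * x)))) \<longlongrightarrow> 0) (at_left 1)"
          using tendsto_ennrealI[OF Re0] by simp
        show "\<forall>\<^sub>F r in at_left 1. ennreal (Re (Q (planar lam) (of_real r * x))) = poisson (planar lam) (of_real r * x)"
          using unit by eventually_elim (use disc \<open>norm x = 1\<close> L.poisson_eq in auto)
      qed
      then have "x \<in> zero_set lam"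
        by (rule zero_set_of_poisson_tendsto_0[OF lam(1,2) \<open>norm x = 1\<close>])
      ultimately show "x \<in> Z" by (simp add: assms(7))
    qed
  qed
  \<comment> \<open>conversely, the absolutely continuous part does not see the countable set \<open>Z\<close>\<close>
  have Z_ac: "AE x in planar mu. x \<in> Z \<longrightarrow> x \<in> S"
  proof -
    have "emeasure (planar mu) (Z - S) = emeasure (density (planar mu) (indicator (- S))) Z"
      by (subst emeasure_restricted) (auto simp: Diff_eq Int_commute)
    also have "\<dots> = (\<integral>\<^sup>+z. g z * indicator Z z \<partial>circle_uniform)" unfolding S(3) by (rule emeasure_density) auto
    also have "\<dots> = (\<integral>\<^sup>+z. 0 \<partial>circle_uniform)"
      by (rule nn_integral_cong_AE) (use AE_not_in[OF Z_null] in \<open>eventually_elim, simp\<close>)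
    finally have "Z - S \<in> null_sets (planar mu)" by (simp add: null_sets_def)
    then show ?thesis using AE_not_in by fastforce
  qed
  have atom: "emeasure (planar mu) {x} = beta lam x" if "x \<in> Z" for x
  proof -
    have x: "norm x = 1" using that Z_sphere by auto
    have "x \<in> H_level lam c0" using that unfolding assms(7) by (rule IntD2)
    then obtain h where h: "has_H lam x h" "H lam x + c0 = 0" unfolding H_level_def by blast
    then have "H lam x = h" unfolding H_def has_H_def by (intro tendsto_Lim) simp_all
    then have "h = - c0" using h(2) by simp
    then have "((\<lambda>r. Im (Q (planar lam) (of_real r * x))) \<longlongrightarrow> - c0) (at_left 1)"
      using h(1) by (simp add: has_H_def Q)
    then show ?thesis
      using M.measure_singleton_reciprocal[OF L.circle_measure_axioms lam_ne recip x]
        beta_eq_energy[OF lam(1,2) x] by simp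
  qed
  have main: "emeasure mu A = (\<integral>\<^sup>+z\<in>A. ennreal (mu_c z) \<partial>circle_lebesgue) +
      (\<Sum>\<^sub>\<infinity>\<zeta>\<in>Z. beta lam \<zeta> * emeasure (return circle_borel \<zeta>) A)" if A: "A \<in> sets circle_borel" for A
  proof -
    have A': "A \<subseteq> sphere 0 1" and [measurable]: "A \<in> sets borel" using A by (auto simp: sets_circle_borel_iff)
    have "emeasure mu A = emeasure (planar mu) A"
      using A' by (subst emeasure_planar[OF mu(1)]) (auto simp: Int_absorb2)
    also have "\<dots> = emeasure (planar mu) ((A - S) \<union> (A \<inter> S))" by (rule arg_cong[where f="emeasure _"]) auto
    also have "\<dots> = emeasure (planar mu) (A - S) + emeasure (planar mu) (A \<inter> S)"
      by (rule plus_emeasure[symmetric]) auto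
    also have "emeasure (planar mu) (A \<inter> S) = emeasure (planar mu) (A \<inter> Z)"
      by (rule emeasure_eq_AE) (use sing Z_ac in \<open>eventually_elim, auto\<close>)
    also have "\<dots> = (\<Sum>\<^sub>\<infinity>\<zeta>\<in>Z. emeasure (planar mu) {\<zeta>} * indicator A \<zeta>)"
      by (rule emeasure_Int_countable[OF Z_count]) simp
    also have "\<dots> = (\<Sum>\<^sub>\<infinity>\<zeta>\<in>Z. beta lam \<zeta> * emeasure (return circle_borel \<zeta>) A)"
      by (rule infsum_cong) (use A in \<open>simp add: atom\<close>)
    finally show ?thesis by (simp add: ac)
  qed
  show ?thesis using int Z_sub Z_disc main total by blast
qed

end
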